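(* Let $L$ be a semimodular lattice of rank $n$, and let $C, D$ be flags of $L$. Then: (1) The modular convex hull $\mathrm{mConv}(C \cup D)$, regarded as a subposet of $L$, is isomorphic (as a poset) to a pre-antimatroid $\mathcal{K}$ on $[n]$. (2) A flag $F$ of $L$ is contained in $\mathrm{mConv}(C \cup D)$ if and only if $F$ belongs to a shortest gallery between $C$ and $D$. In particular, the union of all flags of all shortest galleries between $C$ and $D$ is isomorphic (as a poset) to the antimatroid $\mathcal{K}^*$, where $\mathcal{K}$ is the pre-antimatroid of part (1).
   Context: All lattices have a minimum $0$ and maximum $1$ and finite rank; the rank $r(p)$ of $p$ is the maximum length of a chain from $0$ to $p$ (the length of a chain is its cardinality minus one), and the rank of $L$ is $r(1)$. $L$ is (upper) semimodular: if $a$ covers $a\wedge b$ then $a\vee b$ covers $b$. A flag is a maximal chain $0=c_0<c_1<\cdots<c_n=1$. A pair $(p,q)$ is modular if $(x\vee p)\wedge q = x\vee(p\wedge q)$ for every $x\le q$; in a semimodular lattice this is equivalent to $r(p)+r(q)=r(p\wedge q)+r(p\vee q)$. A subset $S\subseteq L$ is modular convex if for every modular pair $p,q\in S$ we have $p\vee q, p\wedge q\in S$; $\mathrm{mConv}(S)$ is the smallest modular convex subset containing $S$, ordered by the order of $L$. Two flags $C,D$ are adjacent if $|C\cap D| = n$ (i.e. they differ in exactly one element); a gallery is a path in the resulting graph of flags, and a shortest gallery between $C$ and $D$ is one of minimum length. $[n]=\{1,\dots,n\}$ and $2^{[n]}$ is ordered by inclusion. A pre-antimatroid on a finite set $E$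 is a family $\mathcal{K}\subseteq 2^E$ with $\emptyset,E\in\mathcal{K}$, closed under union, and containing a chain of length $|E|$; $\mathcal{K}^*$ denotes the union of all chains of length $|E|$ in $\mathcal{K}$. An antimatroid on $E$ is a family $\mathcal{A}\subseteq 2^E$ with $\emptyset,E\in\mathcal{A}$, closed under union, and such that every nonempty $X\in\mathcal{A}$ has some $e\in X$ with $X\setminus\{e\}\in\mathcal{A}$ ($\mathcal{K}^*$ is known to be an antimatroid). *)

theory Defs
  imports Main "HOL.Hull"
begin

text \<open>The length of a chain is its cardinality minus one, so a chain of length \<open>k\<close> is a
  (necessarily finite, nonempty) chain of cardinality \<open>Suc k\<close>. The definition is used both for
  lattices and for families of sets, where \<open><\<close> is proper inclusion.\<close>

definition (in order) chain_of_length :: "'a set \<Rightarrow> nat \<Rightarrow> 'a set \<Rightarrow> bool" where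
  "chain_of_length A k S \<longleftrightarrow> pred_on.chain A (<) S \<and> card S = Suc k"

definition (in order) covers :: "'a \<Rightarrow> 'a \<Rightarrow> bool" where
  "covers a b \<longleftrightarrow> b < a \<and> (\<nexists>c. b < c \<and> c < a)"

text \<open>A bound on the lengths of the finite chains also excludes infinite chains, which contain
  finite chains of every length.\<close>

class finite_rank_lattice = bounded_lattice +
  assumes finite_rank: "\<exists>N. \<forall>k S. chain_of_length UNIV k S \<longrightarrow> k \<le> N"

class semimodular_lattice = finite_rank_lattice +
  assumes semimodular: "covers a (inf a b) \<Longrightarrow> covers (sup a b) b"

definition rank :: "'a::finite_rank_lattice \<Rightarrow> nat" where
  "rank p = Max {k. \<exists>S. chain_of_length {bot..p} k S \<and> bot \<in> S \<and> p \<in> S}"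

definition flag :: "'a::finite_rank_lattice set \<Rightarrow> bool" where
  "flag C \<longleftrightarrow> pred_on.maxchain UNIV (<) C"

definition modular_pair :: "'a::lattice \<Rightarrow> 'a \<Rightarrow> bool" where
  "modular_pair p q \<longleftrightarrow> (\<forall>x\<le>q. inf (sup x p) q = sup x (inf p q))"

definition modular_convex :: "'a::lattice set \<Rightarrow> bool" where
  "modular_convex S \<longleftrightarrow>
     (\<forall>p\<in>S. \<forall>q\<in>S. modular_pair p q \<longrightarrow> sup p q \<in> S \<and> inf p q \<in> S)"

definition mConv :: "'a::lattice set \<Rightarrow> 'a set" where
  "mConv S = modular_convex hull S"

lemma modular_convex_mConv: "modular_convex (mConv S)"
  unfolding mConv_def by (rule hull_in) (auto simp: modular_convex_def)

lemma subset_mConv: "S \<subseteq> mConv S"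
  unfolding mConv_def by (rule hull_subset)

lemma mConv_least: "S \<subseteq> T \<Longrightarrow> modular_convex T \<Longrightarrow> mConv S \<subseteq> T"
  unfolding mConv_def by (rule hull_minimal)

definition adjacent :: "'a::finite_rank_lattice set \<Rightarrow> 'a set \<Rightarrow> bool" where
  "adjacent C D \<longleftrightarrow> flag C \<and> flag D \<and> card (C \<inter> D) = rank (top :: 'a)"

definition gallery ::
    "'a::finite_rank_lattice set \<Rightarrow> 'a set \<Rightarrow> 'a set list \<Rightarrow> bool" where
  "gallery C D Fs \<longleftrightarrow> Fs \<noteq> [] \<and> hd Fs = C \<and> last Fs = D \<and> (\<forall>F\<in>set Fs. flag F) \<and>
     successively adjacent Fs \<and> distinct Fs"

definition shortest_gallery ::
    "'a::finite_rank_lattice set \<Rightarrow> 'a set \<Rightarrow> 'a set list \<Rightarrow> bool" where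
  "shortest_gallery C D Fs \<longleftrightarrow> is_arg_min length (gallery C D) Fs"

definition pre_antimatroid :: "'e set \<Rightarrow> 'e set set \<Rightarrow> bool" where
  "pre_antimatroid E K \<longleftrightarrow> finite E \<and> K \<subseteq> Pow E \<and> {} \<in> K \<and> E \<in> K \<and>
     (\<forall>X\<in>K. \<forall>Y\<in>K. X \<union> Y \<in> K) \<and> (\<exists>S. chain_of_length K (card E) S)"

text \<open>The family \<open>K\<^sup>*\<close> for a family \<open>K\<close> on \<open>E\<close>.\<close>

definition star :: "'e set \<Rightarrow> 'e set set \<Rightarrow> 'e set set" where
  "star E K = \<Union>{S. chain_of_length K (card E) S}"

definition antimatroid :: "'e set \<Rightarrow> 'e set set \<Rightarrow> bool" where
  "antimatroid E A \<longleftrightarrow> finite E \<and> A \<subseteq> Pow E \<and> {} \<in> A \<and> E \<in> A \<and>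
     (\<forall>X\<in>A. \<forall>Y\<in>A. X \<union> Y \<in> A) \<and> (\<forall>X\<in>A. X \<noteq> {} \<longrightarrow> (\<exists>e\<in>X. X - {e} \<in> A))"

definition poset_isomorphic :: "'a::order set \<Rightarrow> 'b::order set \<Rightarrow> bool" where
  "poset_isomorphic A B \<longleftrightarrow>
     (\<exists>f. bij_betw f A B \<and> (\<forall>x\<in>A. \<forall>y\<in>A. x \<le> y \<longleftrightarrow> f x \<le> f y))"

end

theory Submission
  imports Defs
begin

text \<open>Write \<open>c\<^sub>i\<close> for the element of rank \<open>i\<close> of the flag \<open>C\<close>, and send \<open>p\<close> to the set
  \<open>f p\<close> of those \<open>i\<close> with \<open>c\<^sub>i \<le> c\<^sub>i\<^sub>-\<^sub>1 \<squnion> p\<close>. By semimodularity \<open>f p\<close> has \<open>r(p)\<close> elements.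
  Let \<open>H\<close> consist of those \<open>p\<close> such that every \<open>i \<notin> f p\<close> is witnessed by some \<open>d \<in> D\<close> with
  \<open>i \<notin> f d\<close> and \<open>p \<le> c\<^sub>i\<^sub>-\<^sub>1 \<squnion> d\<close>. On \<open>H\<close>, which contains both flags, joins become unions under \<open>f\<close>, so
  \<open>f\<close> is an order embedding, and counting ranks shows that \<open>H\<close> is modular convex. Conversely,
  an element of \<open>H\<close> is either the meet of two of its covers in \<open>H\<close>, which form a modular pair,
  or of the form \<open>c \<squnion> d\<close>; by downward induction on the rank it lies in the modular convex hull.

  The gallery distance from \<open>C\<close> to \<open>F\<close> is the number of inversions of the permutation that \<open>f\<close> reads
  off \<open>F\<close>. The flags inside \<open>H\<close> are exactly those whose inversions lie in the weak order below
  the inversions of \<open>D\<close>, which makes the distance from \<open>C\<close> to \<open>D\<close> through \<open>F\<close> additive.\<close>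

subsection \<open>Rank and modular pairs\<close>

lemma chain_less_iff:
  fixes S :: "'a::order set"
  shows "pred_on.chain A (<) S \<longleftrightarrow> S \<subseteq> A \<and> (\<forall>x\<in>S. \<forall>y\<in>S. x \<le> y \<or> y \<le> x)"
  by (auto simp: pred_on.chain_def order.order_iff_strict)

text \<open>Relation powers permit induction along a chain; this and the converse below translate to
  and from sets of given cardinality.\<close>

lemma chain_of_length_if_relpowp_less:
  fixes x :: "'a::order"
  assumes "((<) ^^ k) x y"
  shows "\<exists>S. chain_of_length {x..y} k S \<and> x \<in> S \<and> y \<in> S"
  using assms
proof (induction k arbitrary: y)
  case 0
  then have "chain_of_length {x..y} 0 {x} \<and> x \<in> {x} \<and> y \<in> {x}"
    by (auto simp: chain_of_length_def chain_less_iff)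
  then show ?case by blast
next
  case (Suc k)
  then obtain z where "((<) ^^ k) x z" "z < y"
    by (auto elim: relpowp_Suc_E)
  with Suc.IH obtain S where S: "chain_of_length {x..z} k S" "x \<in> S" "z \<in> S"
    by blast
  have "finite S"
    using S by (auto simp: chain_of_length_def intro: card_ge_0_finite)
  moreover have "\<forall>w\<in>S. x \<le> w \<and> w < y"
    using S \<open>z < y\<close>
    by (metis chain_of_length_def chain_less_iff atLeastAtMost_iff le_less_trans subsetD)
  moreover from this have "y \<notin> S" "x \<le> y" using \<open>x \<in> S\<close> by (auto intro: less_imp_le)
  ultimately have "chain_of_length {x..y} (Suc k) (insert y S)"
    using S by (auto simp: chain_of_length_def chain_less_iff less_imp_le)
  then show ?case using \<open>x \<in> S\<close> by blast
qed

lemma relpowp_less_if_chain_of_length: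
  fixes x :: "'a::order"
  assumes "chain_of_length {x..y} k S" "x \<in> S" "y \<in> S"
  shows "((<) ^^ k) x y"
  using assms
proof (induction k arbitrary: y S)
  case 0
  then have "is_singleton S" by (simp add: chain_of_length_def is_singleton_altdef)
  with 0 show ?case by (auto simp: is_singleton_def)
next
  case (Suc k)
  let ?T = "S - {y}"
  have fin: "finite S" and card: "card ?T = Suc k" and sub: "S \<subseteq> {x..y}"
    and chain: "\<forall>u\<in>S. \<forall>v\<in>S. u \<le> v \<or> v \<le> u"
    using Suc.prems
    by (auto simp: chain_of_length_def chain_less_iff intro: card_ge_0_finite)
  have "?T \<noteq> {}" using card by force
  then obtain z where z: "z \<in> ?T" "\<forall>w\<in>?T. z \<le> w \<longrightarrow> z = w"
    using finite_has_maximal[of ?T] fin by auto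
  have "x \<noteq> y" using z sub by auto
  have "?T \<subseteq> {x..z}" using z sub chain by fastforce
  then have "chain_of_length {x..z} k ?T"
    using card chain unfolding chain_of_length_def chain_less_iff by blast
  then have "((<) ^^ k) x z"
    using Suc.IH z(1) \<open>x \<in> S\<close> \<open>x \<noteq> y\<close> by blast
  moreover have "z < y" using z sub by (auto simp: order.strict_iff_order)
  ultimately show ?case by (rule relpowp_Suc_I)
qed

lemma rank_eq_Max_relpowp:
  "rank (p :: 'a::finite_rank_lattice) = Max {k. ((<) ^^ k) bot p}"
  unfolding rank_def
  by (rule arg_cong[where f = Max])
    (blast intro: chain_of_length_if_relpowp_less relpowp_less_if_chain_of_length)

lemma finite_relpowp_less:
  "finite {k. ((<) ^^ k) bot (p :: 'a::finite_rank_lattice)}"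
proof -
  obtain N where N: "\<And>k S. chain_of_length (UNIV :: 'a set) k S \<Longrightarrow> k \<le> N"
    using finite_rank by metis
  have "k \<le> N" if k: "((<) ^^ k) bot p" for k
  proof -
    obtain S where "chain_of_length {bot..p} k S"
      using chain_of_length_if_relpowp_less[OF k] by blast
    then have "chain_of_length UNIV k S"
      by (auto simp: chain_of_length_def chain_less_iff)
    then show ?thesis by (rule N)
  qed
  then have "{k. ((<) ^^ k) bot p} \<subseteq> {..N}" by blast
  then show ?thesis by (rule finite_subset) simp
qed

lemma relpowp_less_le_rank:
  "((<) ^^ k) bot p \<Longrightarrow> k \<le> rank (p :: 'a::finite_rank_lattice)"
  unfolding rank_eq_Max_relpowp using finite_relpowp_less by (intro Max_ge) auto

lemma relpowp_less_rank:
  "((<) ^^ rank p) bot (p :: 'a::finite_rank_lattice)"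
proof -
  \<comment> \<open>\<open>Max\<close> is a member only of a nonempty set; power 0 or 1 supplies an
    element.\<close>
  have "\<exists>k. ((<) ^^ k) bot p"
  proof (cases "p = bot")
    case True
    then have "((<) ^^ 0) bot p" by simp
    then show ?thesis by blast
  next
    case False
    then have "((<) ^^ 1) bot p" unfolding relpowp_1 by (simp add: bot.not_eq_extremum)
    then show ?thesis by blast
  qed
  then have "rank p \<in> {k. ((<) ^^ k) bot p}"
    unfolding rank_eq_Max_relpowp using finite_relpowp_less by (intro Max_in) auto
  then show ?thesis by simp
qed

lemma rank_less:
  assumes "p < (q :: 'a::finite_rank_lattice)"
  shows "rank p < rank q"
proof -
  have "((<) ^^ Suc (rank p)) bot q"
    using relpowp_less_rank assms by (rule relpowp_Suc_I)
  then have "Suc (rank p) \<le> rank q" by (rule relpowp_less_le_rank)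
  then show ?thesis by simp
qed

lemma rank_le: "p \<le> q \<Longrightarrow> rank p \<le> rank (q :: 'a::finite_rank_lattice)"
  by (metis rank_less order.order_iff_strict less_imp_le order_refl)

lemma eq_if_le_rank: "p \<le> q \<Longrightarrow> rank q \<le> rank p \<Longrightarrow> p = (q :: 'a::finite_rank_lattice)"
  by (metis rank_less order.strict_iff_order not_le)

lemma rank_bot [simp]: "rank (bot :: 'a::finite_rank_lattice) = 0"
proof (rule ccontr)
  assume "rank (bot :: 'a) \<noteq> 0"
  then obtain k where "rank (bot :: 'a) = Suc k" using not0_implies_Suc by blast
  then have "((<) ^^ Suc k) bot (bot :: 'a)" using relpowp_less_rank[of "bot :: 'a"] by simp
  then show False by (auto elim: relpowp_Suc_E)
qed

lemma rank_le_top: "rank (p :: 'a::finite_rank_lattice) \<le> rank (top :: 'a)"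
  by (simp add: rank_le)

text \<open>Ranks below \<open>p\<close> are bounded, so some element of the interval from
  \<open>x\<close> up to but excluding \<open>p\<close> has greatest rank; nothing fits between it
  and \<open>p\<close>.\<close>

lemma ex_lower_cover:
  fixes p :: "'a::finite_rank_lattice"
  assumes "x < p"
  shows "\<exists>q. x \<le> q \<and> covers p q"
proof -
  have "\<exists>q. (x \<le> q \<and> q < p) \<and> (\<forall>y. x \<le> y \<and> y < p \<longrightarrow> rank y \<le> rank q)"
    using assms by (intro ex_has_greatest_nat[of _ x _ "rank p"]) (auto intro: rank_less)
  then obtain q where q: "x \<le> q" "q < p" "\<And>y. x \<le> y \<Longrightarrow> y < p \<Longrightarrow> rank y \<le> rank q"
    by blast
  then have "covers p q"
    unfolding covers_def by (meson rank_less less_imp_le order_trans not_le)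
  with q show ?thesis by blast
qed

section \<open>The Jordan-Dedekind chain condition\<close>

lemma relpowp_less_imp_le:
  fixes x :: "'a::order"
  assumes "((<) ^^ k) x y"
  shows "x \<le> y"
  using chain_of_length_if_relpowp_less[OF assms]
  by (auto simp: chain_of_length_def chain_less_iff)

text \<open>Joining a strict chain from \<open>x\<close> to \<open>y\<close> with a cover of \<open>x\<close> identifies at most two
  consecutive members of the chain.\<close>

lemma relpowp_less_shift:
  fixes x :: "'a::semimodular_lattice"
  assumes "((<) ^^ Suc l) x y" "covers u x" "u \<le> y"
  shows "\<exists>m\<ge>l. ((<) ^^ m) u y"
  using assms
proof (induction l arbitrary: x u)
  case 0
  show ?case
  proof (cases "u = y")
    case True
    then have "((<) ^^ 0) u y" by simp
    then show ?thesis by blast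
  next
    case False
    with 0 have "((<) ^^ 1) u y" unfolding relpowp_1 by simp
    then show ?thesis by blast
  qed
next
  case (Suc l)
  obtain z where z: "x < z" "((<) ^^ Suc l) z y"
    by (rule relpowp_Suc_E2[OF Suc.prems(1)])
  have "x < u" using Suc.prems(2) by (simp add: covers_def)
  show ?case
  proof (cases "u \<le> z")
    case True
    show ?thesis
    proof (cases "u = z")
      case True
      then show ?thesis using z by blast
    next
      case False
      with \<open>u \<le> z\<close> z have "((<) ^^ Suc (Suc l)) u y"
        by (intro relpowp_Suc_I2[of _ u z]) auto
      then show ?thesis by (meson le_SucI order_refl)
    qed
  next
    case False
    \<comment> \<open>Since \<open>u\<close> covers \<open>x\<close>, its meet with \<open>z\<close>
      can only be \<open>x\<close>. Semimodularity then moves the cover up to \<open>z\<close>,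
      where the induction hypothesis applies.\<close>
    have "inf u z < u" using False by (metis inf_le1 inf_le2 order.order_iff_strict)
    moreover have "x \<le> inf u z" using z(1) \<open>x < u\<close> by (simp add: less_imp_le)
    ultimately have "inf u z = x"
      using Suc.prems(2) unfolding covers_def by (auto simp: order.order_iff_strict)
    with Suc.prems(2) have "covers (sup u z) z"
      by (intro semimodular) simp
    moreover have "z \<le> y" using z(2) by (rule relpowp_less_imp_le)
    ultimately obtain m where m: "m \<ge> l" "((<) ^^ m) (sup u z) y"
      using Suc.IH[OF z(2), of "sup u z"] Suc.prems(3) by auto
    have "\<not> z < u" using z Suc.prems(2) unfolding covers_def by blast
    then have "u \<noteq> sup u z" using False by (metis sup.cobounded2 order.order_iff_strict)
    then have "u < sup u z" by (simp add: order.strict_iff_order)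
    with m have "((<) ^^ Suc m) u y" by (intro relpowp_Suc_I2[of _ u "sup u z"])
    then show ?thesis using m by (meson Suc_le_mono)
  qed
qed

text \<open>By \<open>relpowp_less_shift\<close>, replacing \<open>x\<close> by its first cover
  costs a strict chain at most one step. Hence chains of covers are longest between their
  ends.\<close>

lemma relpowp_less_le_relpowp_covers:
  fixes x :: "'a::semimodular_lattice"
  assumes "((\<lambda>a b. covers b a) ^^ k) x y" "((<) ^^ l) x y"
  shows "l \<le> k"
  using assms
proof (induction k arbitrary: x l)
  case 0
  have "l = 0"
  proof (cases l)
    case (Suc j)
    with 0 obtain z where "x < z" "((<) ^^ j) z x"
      using relpowp_Suc_E2[of j "(<)" x x] by auto
    then show ?thesis using relpowp_less_imp_le[of j z x] by simp
  qed
  then show ?case by simp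
next
  case (Suc k)
  obtain u where u: "covers u x" "((\<lambda>a b. covers b a) ^^ k) u y"
    using relpowp_Suc_E2[OF Suc.prems(1)] by blast
  then have "((<) ^^ k) u y"
    using relpowp_mono[of "\<lambda>a b. covers b a" "(<)" k u y] by (auto simp: covers_def)
  then have "u \<le> y" by (rule relpowp_less_imp_le)
  show ?case
  proof (cases l)
    case (Suc j)
    with relpowp_less_shift[of j x y u] Suc.prems(2) u(1) \<open>u \<le> y\<close>
    obtain m where "j \<le> m" "((<) ^^ m) u y" by auto
    with Suc.IH[OF u(2)] Suc show ?thesis by force
  qed simp
qed

lemma relpowp_covers_rank:
  fixes p :: "'a::semimodular_lattice"
  shows "((\<lambda>a b. covers b a) ^^ rank p) bot p"
proof (induction "rank p" arbitrary: p rule: less_induct)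
  case less
  show ?case
  proof (cases "p = bot")
    case False
    then obtain q where q: "covers p q"
      using ex_lower_cover[of bot p] by (auto simp: bot.not_eq_extremum)
    then have "((\<lambda>a b. covers b a) ^^ rank q) bot q"
      by (intro less rank_less) (simp add: covers_def)
    with q have *: "((\<lambda>a b. covers b a) ^^ Suc (rank q)) bot p"
      by (intro relpowp_Suc_I)
    have "rank p \<le> Suc (rank q)"
      by (rule relpowp_less_le_relpowp_covers[OF * relpowp_less_rank])
    moreover have "rank q < rank p" using q by (auto simp: covers_def intro: rank_less)
    ultimately have "rank p = Suc (rank q)" by simp
    with * show ?thesis by simp
  qed simp
qed

lemma rank_covers:
  fixes p :: "'a::semimodular_lattice"
  assumes "covers p q"
  shows "rank p = Suc (rank q)"
proof (rule antisym)
  have "((\<lambda>a b. covers b a) ^^ Suc (rank q)) bot p"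
    using relpowp_covers_rank assms by (rule relpowp_Suc_I)
  then show "rank p \<le> Suc (rank q)"
    using relpowp_less_rank by (rule relpowp_less_le_relpowp_covers)
  show "Suc (rank q) \<le> rank p"
    using assms by (simp add: covers_def Suc_le_eq rank_less)
qed

lemma covers_iff_rank:
  fixes p :: "'a::semimodular_lattice"
  shows "covers p q \<longleftrightarrow> q < p \<and> rank p = Suc (rank q)"
proof
  assume *: "q < p \<and> rank p = Suc (rank q)"
  have False if "q < c" "c < p" for c
    using rank_less[OF that(1)] rank_less[OF that(2)] * by simp
  with * show "covers p q" by (auto simp: covers_def)
qed (auto simp: rank_covers, simp add: covers_def)

text \<open>If \<open>a\<close> is not below \<open>sup b x\<close>, the rank bound forces
  \<open>a\<close> to cover \<open>inf a (sup b x)\<close>, and semimodularity makes the join a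
  cover of \<open>sup b x\<close>.\<close>

lemma rank_sup_le_Suc:
  fixes a :: "'a::semimodular_lattice"
  assumes "b \<le> a" "rank a \<le> Suc (rank b)"
  shows "rank (sup a x) \<le> Suc (rank (sup b x))"
proof (cases "a \<le> sup b x")
  case True
  then have "sup a x \<le> sup b x" by simp
  then show ?thesis using rank_le by (metis le_SucI)
next
  case False
  let ?i = "inf a (sup b x)"
  have "?i < a" using False by (metis inf_le1 inf_le2 order.order_iff_strict)
  then have "rank ?i < rank a" by (rule rank_less)
  moreover have "b \<le> ?i" using assms by simp
  then have "rank b \<le> rank ?i" by (rule rank_le)
  ultimately have "covers a ?i" using \<open>?i < a\<close> assms(2) by (simp add: covers_iff_rank)
  then have "covers (sup a (sup b x)) (sup b x)" by (rule semimodular)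
  moreover have "sup a (sup b x) = sup a x"
    using assms(1) by (simp add: sup.assoc[symmetric] sup.absorb1)
  ultimately show ?thesis by (simp add: rank_covers)
qed

section \<open>Modular pairs\<close>

text \<open>If \<open>x\<close> is not below \<open>p\<close>, then \<open>sup x (inf p q)\<close>
  lies strictly above \<open>inf p q\<close> and below \<open>q\<close>, so it is \<open>q\<close>.
  This supplies all modular pairs used to generate the hull.\<close>

lemma modular_pair_if_covers:
  fixes p :: "'a::lattice"
  assumes "covers q (inf p q)"
  shows "modular_pair p q"
  unfolding modular_pair_def
proof (intro allI impI)
  fix x assume "x \<le> q"
  show "inf (sup x p) q = sup x (inf p q)"
  proof (cases "x \<le> p")
    case True
    with \<open>x \<le> q\<close> show ?thesis by (simp add: sup.absorb2)
  next
    case False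
    have "sup x (inf p q) \<le> q" using \<open>x \<le> q\<close> by simp
    moreover have "inf p q < sup x (inf p q)"
      using False by (metis inf.bounded_iff order.order_iff_strict sup.cobounded2 sup.cobounded1)
    ultimately have "sup x (inf p q) = q"
      using assms unfolding covers_def by (auto simp: order.order_iff_strict)
    moreover have "sup x (inf p q) \<le> sup x p" by (simp add: le_supI2)
    ultimately show ?thesis by (simp add: inf.absorb2)
  qed
qed

text \<open>Modularity recovers each \<open>z\<close> between \<open>inf p q\<close> and
  \<open>q\<close> from \<open>sup z p\<close>, so joining with \<open>p\<close> keeps a chain of
  covers from \<open>inf p q\<close> to \<open>q\<close> strict.\<close>

lemma rank_modular_pair:
  fixes p :: "'a::semimodular_lattice"
  assumes "modular_pair p q"
  shows "rank p + rank q \<le> rank (inf p q) + rank (sup p q)"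
proof -
  have "rank p + rank x \<le> rank (inf p q) + rank (sup x p)" if "inf p q \<le> x" "x \<le> q" for x
    using that
  proof (induction "rank x" arbitrary: x rule: less_induct)
    case less
    show ?case
    proof (cases "inf p q = x")
      case True
      then show ?thesis using rank_le[of p "sup x p"] by simp
    next
      case False
      then obtain y where y: "inf p q \<le> y" "covers x y"
        using less.prems ex_lower_cover[of "inf p q" x] by (auto simp: order.strict_iff_order)
      then have "y < x" by (simp add: covers_def)
      have *: "inf (sup z p) q = z" if "inf p q \<le> z" "z \<le> q" for z
        using assms that by (simp add: modular_pair_def sup.absorb1)
      have "y \<le> q" using \<open>y < x\<close> less.prems by simp
      have "sup y p \<noteq> sup x p"
        using *[OF y(1) \<open>y \<le> q\<close>] *[OF less.prems] \<open>y < x\<close> by (metis less_irrefl)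
      moreover have "sup y p \<le> sup x p" 
        using sup_mono[of y x p p] \<open>y < x\<close> by simp
      ultimately have "rank (sup y p) < rank (sup x p)"
        by (metis rank_less order.strict_iff_order)
      moreover have "rank p + rank y \<le> rank (inf p q) + rank (sup y p)"
        using less.hyps[OF rank_less[OF \<open>y < x\<close>] y(1) \<open>y \<le> q\<close>] .
      ultimately show ?thesis using y(2) by (simp add: rank_covers)
    qed
  qed
  from this[of q] show ?thesis by (simp add: sup.commute)
qed

section \<open>Flags as chains of full length\<close>

lemma inj_on_rank_chain:
  fixes S :: "'a::finite_rank_lattice set"
  assumes "pred_on.chain A (<) S"
  shows "inj_on rank S"
  using assms eq_if_le_rank by (fastforce simp: chain_less_iff inj_on_def)

text \<open>If rank \<open>k\<close> were missing, take the members \<open>x\<close> and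
  \<open>y\<close> with ranks closest to \<open>k\<close> from below and above. Their ranks differ
  by at least two, so some \<open>z\<close> lies strictly between. It is comparable with all of
  \<open>C\<close>, so maximality puts it into \<open>C\<close>, against the choice of
  \<open>x\<close> and \<open>y\<close>.\<close>

lemma rank_image_flag:
  fixes C :: "'a::semimodular_lattice set"
  assumes "flag C"
  shows "rank ` C = {..rank (top :: 'a)}"
proof (rule antisym)
  show "rank ` C \<subseteq> {..rank (top :: 'a)}" by (auto simp: rank_le_top)
  have comp: "x \<le> y \<or> y \<le> x" if "x \<in> C" "y \<in> C" for x y
    using assms that by (auto simp: flag_def pred_on.maxchain_def chain_less_iff)
  have max: "z \<in> C" if z: "\<And>w. w \<in> C \<Longrightarrow> z \<le> w \<or> w \<le> z" for z
  proof (rule ccontr)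
    assume "z \<notin> C"
    moreover have "pred_on.chain UNIV (<) (insert z C)"
      using z comp by (auto simp: chain_less_iff)
    ultimately show False
      using assms unfolding flag_def pred_on.maxchain_def by blast
  qed
  have comp_rank: "x \<le> y" if "x \<in> C" "y \<in> C" "rank x \<le> rank y" for x y
    using comp that eq_if_le_rank by blast
  show "{..rank (top :: 'a)} \<subseteq> rank ` C"
  proof
    fix k assume k: "k \<in> {..rank (top :: 'a)}"
    show "k \<in> rank ` C"
    proof (rule ccontr)
      assume nk: "k \<notin> rank ` C"
      have "bot \<in> C" "top \<in> C" by (simp_all add: max)
      have "rank (bot :: 'a) \<noteq> k" "rank (top :: 'a) \<noteq> k" using nk \<open>bot \<in> C\<close> \<open>top \<in> C\<close> by blast+
      then have "0 < k" "k < rank (top :: 'a)" using k by auto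
      have "\<exists>x. (x \<in> C \<and> rank x < k) \<and> (\<forall>w. w \<in> C \<and> rank w < k \<longrightarrow> rank w \<le> rank x)"
        using \<open>bot \<in> C\<close> \<open>0 < k\<close> by (intro ex_has_greatest_nat[of _ bot _ k]) auto
      then obtain x where x: "x \<in> C" "rank x < k" "\<And>w. w \<in> C \<Longrightarrow> rank w < k \<Longrightarrow> rank w \<le> rank x"
        by blast
      have "\<exists>y. (y \<in> C \<and> k < rank y) \<and> (\<forall>w. w \<in> C \<and> k < rank w \<longrightarrow> rank y \<le> rank w)"
        using \<open>top \<in> C\<close> \<open>k < rank top\<close> by (intro ex_has_least_nat[of _ top]) auto
      then obtain y where y: "y \<in> C" "k < rank y" "\<And>w. w \<in> C \<Longrightarrow> k < rank w \<Longrightarrow> rank y \<le> rank w"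
        by blast
      have "x \<le> y" using x y by (intro comp_rank) auto
      then have "x < y" using x y by (auto simp: order.strict_iff_order)
      moreover have "\<not> covers y x" using x y by (simp add: covers_iff_rank)
      ultimately obtain z where z: "x < z" "z < y" by (auto simp: covers_def)
      have "z \<in> C"
      proof (rule max)
        fix w assume "w \<in> C"
        then have "rank w \<noteq> k" using nk by blast
        then consider "rank w < k" | "k < rank w" by linarith
        then show "z \<le> w \<or> w \<le> z"
        proof cases
          case 1
          then have "w \<le> x" using x \<open>w \<in> C\<close> by (intro comp_rank) auto
          then show ?thesis using z by auto
        next
          case 2
          then have "y \<le> w" using y \<open>w \<in> C\<close> by (intro comp_rank) auto
          then show ?thesis using z by auto
        qed
      qed
      then have "rank z \<noteq> k" using nk by blast
      then show False
        using x(3)[OF \<open>z \<in> C\<close>] y(3)[OF \<open>z \<in> C\<close>] rank_less[OF z(1)] rank_less[OF z(2)] by linarith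
    qed
  qed
qed

text \<open>Turns maximality into counting: \<open>rank\<close> is injective on chains, so none has
  more than \<open>Suc (rank top)\<close> elements.\<close>

lemma flag_iff_chain_of_length:
  fixes C :: "'a::semimodular_lattice set"
  shows "flag C \<longleftrightarrow> chain_of_length UNIV (rank (top :: 'a)) C"
proof
  assume C: "flag C"
  then have ch: "pred_on.chain UNIV (<) C" by (simp add: flag_def pred_on.maxchain_def)
  have "card C = card (rank ` C)" using inj_on_rank_chain[OF ch] by (simp add: card_image)
  with ch show "chain_of_length UNIV (rank (top :: 'a)) C"
    by (simp add: chain_of_length_def rank_image_flag[OF C])
next
  assume C: "chain_of_length UNIV (rank (top :: 'a)) C"
  then have ch: "pred_on.chain UNIV (<) C" and card: "card C = Suc (rank (top :: 'a))"
    by (auto simp: chain_of_length_def)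
  have False if S: "pred_on.chain UNIV (<) S" "C \<subset> S" for S
  proof -
    have "rank ` S \<subseteq> {..rank (top :: 'a)}" by (auto simp: rank_le_top)
    then have "finite S" "card S \<le> card {..rank (top :: 'a)}"
      using inj_on_rank_chain[OF S(1)]
      by (auto intro: inj_on_finite simp del: card_atMost intro!: card_inj_on_le)
    then show False using psubset_card_mono[OF _ S(2)] card by simp
  qed
  with ch show "flag C" unfolding flag_def pred_on.maxchain_def by blast
qed

subsection \<open>Levels of a flag\<close>

text \<open>The \<open>c\<^sub>i\<close> of the overview. It is meaningful for \<open>k\<close> up
  to \<open>rank top\<close>, the range onto which \<open>rank\<close> maps a flag
  bijectively.\<close>

definition level :: "'a::finite_rank_lattice set \<Rightarrow> nat \<Rightarrow> 'a" where
  "level C k = inv_into C rank k"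

lemma chain_flag: "flag C \<Longrightarrow> pred_on.chain UNIV (<) C"
  by (simp add: flag_def pred_on.maxchain_def)

lemma flag_linear:
  "flag C \<Longrightarrow> x \<in> C \<Longrightarrow> y \<in> C \<Longrightarrow> x \<le> y \<or> y \<le> x"
  using chain_flag by (auto simp: chain_less_iff)

lemma flag_le_iff:
  "flag C \<Longrightarrow> x \<in> C \<Longrightarrow> y \<in> C \<Longrightarrow> x \<le> y \<longleftrightarrow> rank x \<le> rank y"
  using flag_linear rank_le eq_if_le_rank by metis

lemma card_flag: "flag C \<Longrightarrow> card C = Suc (rank (top :: 'a))"
  for C :: "'a::semimodular_lattice set"
  by (simp add: flag_iff_chain_of_length chain_of_length_def)

lemma finite_flag: "flag C \<Longrightarrow> finite C"
  for C :: "'a::semimodular_lattice set"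
  by (rule card_ge_0_finite) (simp add: card_flag)

lemma level_in:
  fixes C :: "'a::semimodular_lattice set"
  assumes "flag C" "k \<le> rank (top :: 'a)"
  shows "level C k \<in> C"
  unfolding level_def using assms by (intro inv_into_into) (simp add: rank_image_flag)

lemma rank_level:
  fixes C :: "'a::semimodular_lattice set"
  assumes "flag C" "k \<le> rank (top :: 'a)"
  shows "rank (level C k) = k"
  unfolding level_def using assms by (intro f_inv_into_f) (simp add: rank_image_flag)

lemma level_rank:
  fixes C :: "'a::semimodular_lattice set"
  assumes "flag C" "x \<in> C"
  shows "level C (rank x) = x"
  unfolding level_def
  using inj_on_rank_chain[OF chain_flag[OF assms(1)]] assms(2) by (rule inv_into_f_f)

lemma level_mono:
  fixes C :: "'a::semimodular_lattice set"
  assumes "flag C" "i \<le> j" "j \<le> rank (top :: 'a)"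
  shows "level C i \<le> level C j"
  using assms by (simp add: flag_le_iff level_in rank_level)

lemma level_0:
  fixes C :: "'a::semimodular_lattice set"
  assumes "flag C"
  shows "level C 0 = bot"
  using eq_if_le_rank[of bot "level C 0"] assms by (simp add: rank_level)

lemma level_top:
  fixes C :: "'a::semimodular_lattice set"
  assumes "flag C"
  shows "level C (rank (top :: 'a)) = top"
  using eq_if_le_rank[of "level C (rank (top :: 'a))" top] assms by (simp add: rank_level)

lemma bot_in_flag:
  fixes C :: "'a::semimodular_lattice set"
  shows "flag C \<Longrightarrow> bot \<in> C"
  using level_in[of C 0] by (simp add: level_0)

lemma top_in_flag:
  fixes C :: "'a::semimodular_lattice set"
  shows "flag C \<Longrightarrow> top \<in> C"
  using level_in[of C "rank (top :: 'a)"] by (simp add: level_top)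

section \<open>Indices absorbed by an element\<close>

text \<open>The map \<open>f\<close> of the overview. Indices start at 1, so \<open>i - 1\<close>
  never truncates.\<close>

definition absorbed :: "'a::finite_rank_lattice set \<Rightarrow> 'a \<Rightarrow> nat set" where
  "absorbed C p = {i \<in> {1..rank (top :: 'a)}. level C i \<le> sup (level C (i - 1)) p}"

lemma absorbed_subset: "absorbed C (p :: 'a) \<subseteq> {1..rank (top :: 'a::finite_rank_lattice)}"
  by (auto simp: absorbed_def)

lemma finite_absorbed [simp]: "finite (absorbed C p)"
  by (rule finite_subset[OF absorbed_subset]) simp

lemma absorbed_mono: "p \<le> q \<Longrightarrow> absorbed C p \<subseteq> absorbed C q"
  by (auto simp: absorbed_def intro: order_trans[OF _ sup_mono[OF order_refl]])

text \<open>Joining the levels of \<open>C\<close> onto \<open>p\<close> one after another raises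
  the rank by at most one each time, and by none exactly at the absorbed indices.\<close>

lemma rank_sup_level:
  fixes C :: "'a::semimodular_lattice set"
  assumes "flag C" "k \<le> rank (top :: 'a)"
  shows "rank (sup (level C k) p) = rank p + card ({1..k} - absorbed C p)"
  using assms(2)
proof (induction k)
  case 0
  then show ?case by (simp add: level_0[OF assms(1)])
next
  case (Suc k)
  have le: "level C k \<le> level C (Suc k)"
    using assms(1) Suc.prems by (intro level_mono) auto
  then have mono: "sup (level C k) p \<le> sup (level C (Suc k)) p"
    using sup_mono by blast
  show ?case
  proof (cases "Suc k \<in> absorbed C p")
    case True
    then have "level C (Suc k) \<le> sup (level C k) p" by (simp add: absorbed_def)
    then have "sup (level C (Suc k)) p = sup (level C k) p"
      using mono by (intro antisym) simp_all
    moreover have "{1..Suc k} - absorbed C p = {1..k} - absorbed C p"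
      using True by (auto simp: le_Suc_eq)
    ultimately show ?thesis using Suc by simp
  next
    case False
    then have "\<not> level C (Suc k) \<le> sup (level C k) p"
      using Suc.prems by (simp add: absorbed_def)
    then have "sup (level C k) p \<noteq> sup (level C (Suc k)) p"
      by (metis sup.cobounded1)
    with mono have "rank (sup (level C k) p) < rank (sup (level C (Suc k)) p)"
      by (metis rank_less order.strict_iff_order)
    moreover have "rank (sup (level C (Suc k)) p) \<le> Suc (rank (sup (level C k) p))"
      using le Suc.prems assms(1) by (intro rank_sup_le_Suc) (simp_all add: rank_level)
    moreover have "{1..Suc k} - absorbed C p = insert (Suc k) ({1..k} - absorbed C p)"
      using False by auto
    ultimately show ?thesis using Suc by simp
  qed
qed

text \<open>At the last level the join is \<open>top\<close>, so the indices that are not absorbed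
  account for \<open>rank top - rank p\<close>.\<close>

lemma card_absorbed:
  fixes C :: "'a::semimodular_lattice set"
  assumes "flag C"
  shows "card (absorbed C p) = rank p"
proof -
  let ?n = "rank (top :: 'a)"
  have "?n = rank p + card ({1..?n} - absorbed C p)"
    using rank_sup_level[OF assms order_refl, of p] by (simp add: level_top[OF assms])
  also have "card ({1..?n} - absorbed C p) = ?n - card (absorbed C p)"
    using card_Diff_subset[OF finite_absorbed absorbed_subset, of C p] by simp
  finally show ?thesis
    using card_mono[OF _ absorbed_subset[of C p]] rank_le_top[of p] by simp
qed

lemma absorbed_eqI:
  fixes C :: "'a::semimodular_lattice set"
  assumes "flag C" "X \<subseteq> absorbed C p" "rank p \<le> card X"
  shows "absorbed C p = X"
  using card_seteq[of "absorbed C p" X] assms by (simp add: card_absorbed)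

lemma absorbed_level:
  fixes C :: "'a::semimodular_lattice set"
  assumes "flag C" "k \<le> rank (top :: 'a)"
  shows "absorbed C (level C k) = {1..k}"
proof (rule absorbed_eqI[OF assms(1)])
  show "{1..k} \<subseteq> absorbed C (level C k)"
    using assms level_mono[OF assms(1)] by (auto simp: absorbed_def intro: le_supI2)
qed (simp add: rank_level[OF assms])

lemma eq_if_le_absorbed:
  fixes C :: "'a::semimodular_lattice set"
  assumes "flag C" "p \<le> q" "absorbed C q \<subseteq> absorbed C p"
  shows "p = q"
  using assms card_mono[OF finite_absorbed assms(3)] by (simp add: card_absorbed eq_if_le_rank)

lemma not_absorbed_if_le:
  fixes p :: "'a::semimodular_lattice"
  assumes "i \<in> {1..rank (top :: 'a)}" "i \<notin> absorbed C d" "p \<le> sup (level C (i - 1)) d"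
  shows "i \<notin> absorbed C p"
proof
  assume "i \<in> absorbed C p"
  then have "level C i \<le> sup (level C (i - 1)) p" by (simp add: absorbed_def)
  also have "\<dots> \<le> sup (level C (i - 1)) d" using assms(3) by simp
  finally show False using assms(1,2) by (simp add: absorbed_def)
qed

subsection \<open>The modular convex hull of two flags\<close>

text \<open>The set \<open>H\<close> of the overview. The witness \<open>d\<close> certifies
  \<open>i \<notin> absorbed C p\<close> in a form that survives joins, which the bare
  non-membership need not do.\<close>

definition twin_hull :: "'a::finite_rank_lattice set \<Rightarrow> 'a set \<Rightarrow> 'a set" where
  "twin_hull C D = {p. \<forall>i \<in> {1..rank (top :: 'a)} - absorbed C p.
     \<exists>d\<in>D. i \<notin> absorbed C d \<and> p \<le> sup (level C (i - 1)) d}"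

lemma twin_hullD:
  "p \<in> twin_hull C D \<Longrightarrow> i \<in> {1..rank (top :: 'a)} \<Longrightarrow> i \<notin> absorbed C p \<Longrightarrow>
    \<exists>d\<in>D. i \<notin> absorbed C d \<and> p \<le> sup (level C (i - 1)) d"
  for p :: "'a::finite_rank_lattice"
  unfolding twin_hull_def by blast

lemma le_sup_trans: "p \<le> sup a d \<Longrightarrow> d \<le> e \<Longrightarrow> p \<le> sup a e" for p :: "'a::lattice"
  by (rule order_trans[OF _ sup_mono[OF order_refl]])

text \<open>For an index outside both sets, the larger of the two witnesses in the chain
  \<open>D\<close> serves both elements, hence also their join.\<close>

lemma twin_hull_sup:
  fixes C D :: "'a::semimodular_lattice set"
  assumes "flag C" "flag D" "p \<in> twin_hull C D" "q \<in> twin_hull C D"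
  shows absorbed_sup: "absorbed C (sup p q) = absorbed C p \<union> absorbed C q"
    and sup_in_twin_hull: "sup p q \<in> twin_hull C D"
proof -
  have *: "\<exists>d\<in>D. i \<notin> absorbed C d \<and> sup p q \<le> sup (level C (i - 1)) d"
    if i: "i \<in> {1..rank (top :: 'a)}" "i \<notin> absorbed C p" "i \<notin> absorbed C q" for i
  proof -
    obtain d e where d: "d \<in> D" "i \<notin> absorbed C d" "p \<le> sup (level C (i - 1)) d"
      and e: "e \<in> D" "i \<notin> absorbed C e" "q \<le> sup (level C (i - 1)) e"
      using twin_hullD[OF assms(3) i(1,2)] twin_hullD[OF assms(4) i(1,3)] by blast
    show ?thesis
    proof (cases "d \<le> e")
      case True
      then have "p \<le> sup (level C (i - 1)) e" by (rule le_sup_trans[OF d(3)])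
      with e show ?thesis by auto
    next
      case False
      then have "e \<le> d" using flag_linear[OF assms(2) d(1) e(1)] by blast
      then have "q \<le> sup (level C (i - 1)) d" by (rule le_sup_trans[OF e(3)])
      with d show ?thesis by auto
    qed
  qed
  have "absorbed C p \<union> absorbed C q \<subseteq> absorbed C (sup p q)"
    by (simp add: absorbed_mono)
  moreover have "absorbed C (sup p q) \<subseteq> absorbed C p \<union> absorbed C q"
    using * not_absorbed_if_le absorbed_subset[of C "sup p q"] by blast
  ultimately show eq: "absorbed C (sup p q) = absorbed C p \<union> absorbed C q" by blast
  show "sup p q \<in> twin_hull C D"
    unfolding twin_hull_def mem_Collect_eq eq
  proof
    fix i assume "i \<in> {1..rank (top :: 'a)} - (absorbed C p \<union> absorbed C q)"
    then show "\<exists>d\<in>D. i \<notin> absorbed C d \<and> sup p q \<le> sup (level C (i - 1)) d"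
      using * by simp
  qed
qed

text \<open>Under inclusion, \<open>sup p q\<close> absorbs the same indices as \<open>q\<close>; it
  then has the same rank and equals \<open>q\<close>.\<close>

lemma absorbed_le_iff:
  fixes C D :: "'a::semimodular_lattice set"
  assumes "flag C" "flag D" "p \<in> twin_hull C D" "q \<in> twin_hull C D"
  shows "absorbed C p \<subseteq> absorbed C q \<longleftrightarrow> p \<le> q"
proof
  assume "absorbed C p \<subseteq> absorbed C q"
  then have "q = sup p q"
    using assms by (intro eq_if_le_absorbed[of C]) (simp_all add: absorbed_sup)
  then show "p \<le> q" by (simp add: le_iff_sup)
qed (rule absorbed_mono)

lemma level_in_twin_hull:
  fixes C D :: "'a::semimodular_lattice set"
  assumes "flag C" "flag D" "k \<le> rank (top :: 'a)"
  shows "level C k \<in> twin_hull C D"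
  unfolding twin_hull_def
proof (intro CollectI ballI)
  fix i assume i: "i \<in> {1..rank (top :: 'a)} - absorbed C (level C k)"
  then have "k \<le> i - 1" using assms by (auto simp: absorbed_level)
  then have "level C k \<le> level C (i - 1)" using assms i by (intro level_mono) auto
  moreover have "i \<notin> absorbed C bot"
    \<comment> \<open>The witness is \<open>bot\<close>, because \<open>level C k\<close> is already
      below \<open>level C (i - 1)\<close>.\<close>
    using absorbed_mono[of bot "level C k"] i by auto
  ultimately show "\<exists>d\<in>D. i \<notin> absorbed C d \<and> level C k \<le> sup (level C (i - 1)) d"
    using bot_in_flag[OF assms(2)] by (intro bexI[of _ bot]) simp_all
qed

lemma flags_subset_twin_hull:
  fixes C D :: "'a::semimodular_lattice set"
  assumes "flag C" "flag D"
  shows "C \<union> D \<subseteq> twin_hull C D"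
proof -
  have "C \<subseteq> twin_hull C D"
    using level_in_twin_hull[OF assms rank_le_top] level_rank[OF assms(1)] by (metis subsetI)
  \<comment> \<open>Each element of \<open>D\<close> is its own witness.\<close>
  moreover have "D \<subseteq> twin_hull C D" by (auto simp: twin_hull_def)
  ultimately show ?thesis by simp
qed

text \<open>The join absorbs the union, so the rank inequality for a modular pair forces the meet to
  absorb the whole intersection. An index missing from the meet is thus missing from
  \<open>p\<close> or \<open>q\<close>, whose witness also serves the smaller element.\<close>

lemma modular_convex_twin_hull:
  fixes C D :: "'a::semimodular_lattice set"
  assumes "flag C" "flag D"
  shows "modular_convex (twin_hull C D)"
  unfolding modular_convex_def
proof (intro ballI impI conjI)
  fix p q assume p: "p \<in> twin_hull C D" and q: "q \<in> twin_hull C D" and mod: "modular_pair p q"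
  show "sup p q \<in> twin_hull C D" using assms p q by (rule sup_in_twin_hull)
  have "card (absorbed C p \<union> absorbed C q) + card (absorbed C p \<inter> absorbed C q)
      = card (absorbed C p) + card (absorbed C q)"
    by (rule card_Un_Int[symmetric]) simp_all
  then have "card (absorbed C p \<inter> absorbed C q) + rank (sup p q) = rank p + rank q"
    by (simp only: absorbed_sup[OF assms p q, symmetric] card_absorbed[OF assms(1)] add.commute)
  also have "\<dots> \<le> rank (inf p q) + rank (sup p q)" using mod by (rule rank_modular_pair)
  finally have "card (absorbed C p \<inter> absorbed C q) \<le> card (absorbed C (inf p q))"
    using assms by (simp add: card_absorbed)
  moreover have "absorbed C (inf p q) \<subseteq> absorbed C p \<inter> absorbed C q"
    by (simp add: absorbed_mono)
  ultimately have eq: "absorbed C (inf p q) = absorbed C p \<inter> absorbed C q"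
    by (intro card_seteq) auto
  show "inf p q \<in> twin_hull C D"
    unfolding twin_hull_def
  proof (intro CollectI ballI)
    fix i assume i: "i \<in> {1..rank (top :: 'a)} - absorbed C (inf p q)"
    then consider "i \<notin> absorbed C p" | "i \<notin> absorbed C q" using eq by blast
    then show "\<exists>d\<in>D. i \<notin> absorbed C d \<and> inf p q \<le> sup (level C (i - 1)) d"
      using p q i unfolding twin_hull_def by cases (blast intro: le_infI1 le_infI2)+
  qed
qed

section \<open>Generating the twin hull by modular pairs\<close>

lemma mConv_modular:
  "p \<in> mConv S \<Longrightarrow> q \<in> mConv S \<Longrightarrow> modular_pair p q \<Longrightarrow> sup p q \<in> mConv S \<and> inf p q \<in> mConv S"
  using modular_convex_mConv[of S] unfolding modular_convex_def by blast

text \<open>Induction on \<open>k\<close>: unless the next level of \<open>C\<close> is already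
  below the join, it covers its meet with the join, so the two form a modular pair.\<close>

lemma sup_in_mConv:
  fixes C D :: "'a::semimodular_lattice set"
  assumes "flag C" "flag D" "d \<in> D" "k \<le> rank (top :: 'a)"
  shows "sup (level C k) d \<in> mConv (C \<union> D)"
  using assms(4)
proof (induction k)
  case 0
  then show ?case using assms subset_mConv[of "C \<union> D"] by (auto simp: level_0)
next
  case (Suc k)
  let ?s = "sup (level C k) d"
  have le: "level C k \<le> level C (Suc k)"
    using assms(1) Suc.prems by (intro level_mono) auto
  then have "sup ?s (level C (Suc k)) = sup (level C (Suc k)) d"
    by (simp add: sup.commute sup.left_commute sup.absorb2)
  moreover have "sup ?s (level C (Suc k)) \<in> mConv (C \<union> D)"
  proof (cases "level C (Suc k) \<le> ?s")
    case True
    then show ?thesis using Suc by (simp add: sup.absorb1)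
  next
    case False
    let ?i = "inf ?s (level C (Suc k))"
    have "?i < level C (Suc k)" using False by (metis inf_le1 inf_le2 order.order_iff_strict)
    moreover have "level C k \<le> ?i" using le by simp
    then have "k \<le> rank ?i" using rank_le[of "level C k" ?i] assms(1) Suc.prems by (simp add: rank_level)
    moreover have "rank (level C (Suc k)) = Suc k" using assms(1) Suc.prems by (simp add: rank_level)
    ultimately have "covers (level C (Suc k)) ?i"
      using rank_less[of ?i "level C (Suc k)"] by (simp add: covers_iff_rank)
    then have "modular_pair ?s (level C (Suc k))" by (rule modular_pair_if_covers)
    moreover have "level C (Suc k) \<in> mConv (C \<union> D)"
      using level_in[OF assms(1) Suc.prems] subset_mConv by blast
    ultimately show ?thesis using mConv_modular[of ?s "C \<union> D"] Suc by simp
  qed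
  ultimately show ?case by simp
qed

text \<open>At the first level of \<open>D\<close> not below \<open>p\<close>, the join with
  \<open>p\<close> raises the rank by exactly one. So each flag singles out a cover of
  \<open>p\<close>.\<close>

lemma covers_sup_level:
  fixes D :: "'a::semimodular_lattice set"
  assumes "flag D" "p \<noteq> top"
  shows "\<exists>j. Suc j \<le> rank (top :: 'a) \<and> level D j \<le> p \<and> \<not> level D (Suc j) \<le> p \<and>
    covers (sup p (level D (Suc j))) p"
proof -
  let ?n = "rank (top :: 'a)"
  have "\<not> level D ?n \<le> p" using assms by (simp add: level_top top.extremum_unique)
  moreover have "level D 0 \<le> p" using assms by (simp add: level_0)
  ultimately obtain j where j: "j < ?n" "level D j \<le> p" "\<not> level D (Suc j) \<le> p"
    using ex_least_nat_less[of "\<lambda>k. \<not> level D k \<le> p" ?n] by (metis le_refl)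
  let ?q = "sup p (level D (Suc j))"
  have "rank (sup (level D (Suc j)) p) \<le> Suc (rank (sup (level D j) p))"
    using assms(1) j by (intro rank_sup_le_Suc) (simp_all add: level_mono rank_level)
  then have "rank ?q \<le> Suc (rank p)" using j by (simp add: sup.commute sup.absorb1)
  moreover have "p < ?q" using j by (simp add: order.strict_iff_order) (metis sup.cobounded2)
  ultimately have "covers ?q p" using rank_less[of p ?q] by (simp add: covers_iff_rank)
  with j show ?thesis by (intro exI[of _ j]) simp
qed

lemma twin_hull_subset_mConv:
  fixes C D :: "'a::semimodular_lattice set"
  assumes C: "flag C" and D: "flag D" and "p \<in> twin_hull C D"
  shows "p \<in> mConv (C \<union> D)"
  using assms(3)
proof (induction "rank (top :: 'a) - rank p" arbitrary: p rule: less_induct)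
  case less
  let ?H = "twin_hull C D" and ?M = "mConv (C \<union> D)"
  show ?case
  proof (cases "p = top")
    case True
    then show ?thesis using top_in_flag[OF C] subset_mConv by blast
  next
    case False
    then obtain i j where i: "Suc i \<le> rank (top :: 'a)" "level C i \<le> p"
        "\<not> level C (Suc i) \<le> p" "covers (sup p (level C (Suc i))) p"
      and j: "Suc j \<le> rank (top :: 'a)" "level D j \<le> p"
        "\<not> level D (Suc j) \<le> p" "covers (sup p (level D (Suc j))) p"
      using covers_sup_level[OF C] covers_sup_level[OF D] by meson
    let ?q = "sup p (level C (Suc i))" and ?r = "sup p (level D (Suc j))"
    have ci: "level C (Suc i) \<in> ?H" and dj: "level D (Suc j) \<in> ?H"
      using flags_subset_twin_hull[OF C D] level_in[OF C i(1)] level_in[OF D j(1)] by auto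
    have "?q \<in> ?H" "?r \<in> ?H"
      using sup_in_twin_hull[OF C D less.prems] ci dj by auto
    have "rank p < rank (top :: 'a)"
      using False rank_less[of p top] by (simp add: top.not_eq_extremum)
    then have M: "?q \<in> ?M" "?r \<in> ?M"
      using less.hyps[OF _ \<open>?q \<in> ?H\<close>] less.hyps[OF _ \<open>?r \<in> ?H\<close>] rank_covers[OF i(4)] rank_covers[OF j(4)]
      by simp_all
    show ?thesis
    proof (cases "?q = ?r")
      case False
      have "\<not> ?r \<le> ?q"
        using False eq_if_le_rank[of ?r ?q] rank_covers[OF i(4)] rank_covers[OF j(4)] by auto
      then have "inf ?q ?r < ?r" by (metis inf_le1 inf_le2 order.order_iff_strict)
      moreover have "p \<le> inf ?q ?r" by simp
      ultimately have inf: "inf ?q ?r = p"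
        using j(4) unfolding covers_def by (metis order.order_iff_strict)
      then have "modular_pair ?q ?r" using j(4) by (simp add: modular_pair_if_covers)
      then show ?thesis using mConv_modular[OF M] inf by simp
    next
      case True
      \<comment> \<open>The common cover absorbs \<open>Suc i\<close> while \<open>p\<close> does
        not, so \<open>level D (Suc j)\<close> absorbs it. A witness \<open>d\<close> for
        \<open>Suc i\<close> therefore stays below \<open>level D j\<close>, which pins
        \<open>p\<close> down as \<open>sup (level C i) (level D j)\<close>.\<close>
      have "absorbed C (level C (Suc i)) \<subseteq> insert (Suc i) (absorbed C p)"
        using absorbed_mono[OF i(2), of C] C i(1) by (auto simp: absorbed_level le_Suc_eq)
      moreover have "Suc i \<notin> absorbed C p"
        using i(2,3) by (simp add: absorbed_def sup.absorb2)
      moreover have "Suc i \<in> absorbed C ?q"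
        using absorbed_mono[of "level C (Suc i)" ?q C] C i(1) by (auto simp: absorbed_level)
      ultimately have "Suc i \<in> absorbed C (level D (Suc j))"
        using absorbed_sup[OF C D less.prems dj] True by auto
      obtain d where d: "d \<in> D" "Suc i \<notin> absorbed C d" "p \<le> sup (level C i) d"
        using less.prems i(1) \<open>Suc i \<notin> absorbed C p\<close> unfolding twin_hull_def by fastforce
      have "\<not> level D (Suc j) \<le> d"
        using \<open>Suc i \<in> absorbed C (level D (Suc j))\<close> d(2) absorbed_mono[of _ d C] by blast
      then have "rank d \<le> j"
        using flag_le_iff[OF D level_in[OF D j(1)] d(1)] rank_level[OF D j(1)] by simp
      then have "d \<le> level D j"
        using flag_le_iff[OF D d(1) level_in[OF D]] rank_level[OF D] j(1) by simp
      then have "p \<le> sup (level C i) (level D j)"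
        by (rule le_sup_trans[OF d(3)])
      then have "p = sup (level C i) (level D j)"
        using i(2) j(2) by (intro antisym) simp_all
      then show ?thesis using sup_in_mConv[OF C D level_in[OF D]] i(1) j(1) by simp
    qed
  qed
qed

lemma mConv_eq_twin_hull:
  fixes C D :: "'a::semimodular_lattice set"
  assumes "flag C" "flag D"
  shows "mConv (C \<union> D) = twin_hull C D"
  using twin_hull_subset_mConv[OF assms]
    mConv_least[OF flags_subset_twin_hull[OF assms] modular_convex_twin_hull[OF assms]] by blast

section \<open>The pre-antimatroid, its longest chains and the antimatroid\<close>

lemma bij_betw_absorbed:
  fixes C D :: "'a::semimodular_lattice set"
  assumes "flag C" "flag D"
  shows "bij_betw (absorbed C) (twin_hull C D) (absorbed C ` twin_hull C D)"
  by (metis (no_types, lifting) absorbed_le_iff[OF assms] antisym inj_onI inj_on_imp_bij_betw order_refl)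

lemma pre_antimatroid_absorbed:
  fixes C D :: "'a::semimodular_lattice set"
  assumes C: "flag C" and D: "flag D"
  shows "pre_antimatroid {1..rank (top :: 'a)} (absorbed C ` twin_hull C D)"
    (is "pre_antimatroid {1..?n} ?K")
  unfolding pre_antimatroid_def
proof (intro conjI)
  have initial: "{1..k} \<in> ?K" if "k \<le> ?n" for k
    using level_in_twin_hull[OF C D that] absorbed_level[OF C that] by blast
  show "finite {1..?n}" by simp
  show "?K \<subseteq> Pow {1..?n}" using absorbed_subset by blast
  show "{} \<in> ?K" using initial[of 0] by simp
  show "{1..?n} \<in> ?K" by (rule initial) simp
  show "\<forall>X\<in>?K. \<forall>Y\<in>?K. X \<union> Y \<in> ?K"
  proof (intro ballI, elim imageE)
    fix X Y p q
    assume "X = absorbed C p" "p \<in> twin_hull C D" "Y = absorbed C q" "q \<in> twin_hull C D"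
    then show "X \<union> Y \<in> ?K"
      using absorbed_sup[OF C D] sup_in_twin_hull[OF C D] by (intro image_eqI[of _ _ "sup p q"]) simp_all
  qed
  \<comment> \<open>The levels of \<open>C\<close> are sent to the initial segments, which form a
    chain of full length.\<close>
  let ?S = "(\<lambda>k. {1..k}) ` {..?n}"
  have "inj_on (\<lambda>k. {1..k :: nat}) {..?n}"
    by (rule inj_onI) (metis card_atLeastAtMost diff_Suc_1)
  then have "card ?S = Suc (card {1..?n})" by (simp add: card_image)
  moreover have "pred_on.chain ?K (<) ?S"
    unfolding chain_less_iff using initial by fastforce
  ultimately have "chain_of_length ?K (card {1..?n}) ?S" by (simp add: chain_of_length_def)
  then show "\<exists>S. chain_of_length ?K (card {1..?n}) S" by blast
qed

lemma chain_of_length_absorbed_iff: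
  fixes C D :: "'a::semimodular_lattice set"
  assumes C: "flag C" and D: "flag D" and F: "F \<subseteq> twin_hull C D"
  shows "chain_of_length (absorbed C ` twin_hull C D) n (absorbed C ` F) \<longleftrightarrow> chain_of_length UNIV n F"
proof -
  have "card (absorbed C ` F) = card F"
    using bij_betw_absorbed[OF C D] F by (intro card_image) (auto simp: bij_betw_def intro: inj_on_subset)
  moreover have "(\<forall>x\<in>F. \<forall>y\<in>F. absorbed C x \<subseteq> absorbed C y \<or> absorbed C y \<subseteq> absorbed C x) \<longleftrightarrow>
      (\<forall>x\<in>F. \<forall>y\<in>F. x \<le> y \<or> y \<le> x)"
    using F absorbed_le_iff[OF C D] by (meson subsetD)
  ultimately show ?thesis using F by (simp add: chain_of_length_def chain_less_iff image_mono)
qed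

text \<open>The order embedding matches flags inside the twin hull with chains of length
  \<open>rank top\<close> in the image.\<close>

lemma star_absorbed:
  fixes C D :: "'a::semimodular_lattice set"
  assumes C: "flag C" and D: "flag D"
  shows "star {1..rank (top :: 'a)} (absorbed C ` twin_hull C D)
    = absorbed C ` (\<Union>{F. flag F \<and> F \<subseteq> twin_hull C D})"
proof -
  let ?H = "twin_hull C D" and ?n = "rank (top :: 'a)"
  have "{S. chain_of_length (absorbed C ` ?H) ?n S}
      = (\<lambda>F. absorbed C ` F) ` {F. flag F \<and> F \<subseteq> ?H}" (is "?L = ?R")
  proof
    show "?R \<subseteq> ?L"
    proof
      fix S assume "S \<in> ?R"
      then obtain F where "flag F" "F \<subseteq> ?H" "S = absorbed C ` F" by blast
      then show "S \<in> ?L"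
        by (simp add: chain_of_length_absorbed_iff[OF C D] flag_iff_chain_of_length)
    qed
    show "?L \<subseteq> ?R"
    proof
      fix S assume S: "S \<in> ?L"
      then have "S \<subseteq> absorbed C ` ?H" by (simp add: chain_of_length_def chain_less_iff)
      then obtain F where F: "F \<subseteq> ?H" "S = absorbed C ` F" by (meson subset_imageE)
      then show "S \<in> ?R"
        using S by (simp add: chain_of_length_absorbed_iff[OF C D] flag_iff_chain_of_length)
    qed
  qed
  then show ?thesis unfolding star_def by (simp add: image_Union)
qed

text \<open>For the union of \<open>X \<in> S\<close> and \<open>Y \<in> T\<close>, follow \<open>S\<close> up to \<open>X\<close> and then \<open>X \<union> Z\<close> for \<open>Z \<in> T\<close>.\<close>

lemma antimatroid_star:
  assumes "pre_antimatroid E K"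
  shows "antimatroid E (star E K)"
proof -
  have E: "finite E" "K \<subseteq> Pow E" "\<And>X Y. X \<in> K \<Longrightarrow> Y \<in> K \<Longrightarrow> X \<union> Y \<in> K"
    and ex: "\<exists>S. chain_of_length K (card E) S"
    using assms by (auto simp: pre_antimatroid_def)
  have chainD: "S \<subseteq> K" "\<And>X Y. X \<in> S \<Longrightarrow> Y \<in> S \<Longrightarrow> X \<subseteq> Y \<or> Y \<subseteq> X" "card ` S = {..card E}"
    if "chain_of_length K (card E) S" for S
  proof -
    show SK: "S \<subseteq> K" and lin: "\<And>X Y. X \<in> S \<Longrightarrow> Y \<in> S \<Longrightarrow> X \<subseteq> Y \<or> Y \<subseteq> X"
      using that by (auto simp: chain_of_length_def chain_less_iff)
    have fin: "finite X" if "X \<in> S" for X using that SK E by (meson PowD finite_subset subsetD)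
    have "inj_on card S"
      using lin fin by (metis card_subset_eq inj_onI)
    moreover have "card ` S \<subseteq> {..card E}" using SK E by (auto intro!: card_mono)
    moreover have "card S = Suc (card E)" using that by (simp add: chain_of_length_def)
    ultimately show "card ` S = {..card E}"
      by (intro card_subset_eq) (simp_all add: card_image)
  qed
  \<comment> \<open>A chain attaining every cardinality up to \<open>card E\<close> has exactly
    \<open>Suc (card E)\<close> members, because \<open>card\<close> is injective on it.\<close>
  have chainI: "S \<subseteq> star E K"
    if SK: "S \<subseteq> K" and lin: "\<And>X Y. X \<in> S \<Longrightarrow> Y \<in> S \<Longrightarrow> X \<subseteq> Y \<or> Y \<subseteq> X"
      and sur: "{..card E} \<subseteq> card ` S" for S
  proof -
    have fin: "finite X" if "X \<in> S" for X using that SK E by (meson PowD finite_subset subsetD)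
    have inj: "inj_on card S"
      using lin fin by (metis card_subset_eq inj_onI)
    have "card ` S \<subseteq> {..card E}" using SK E by (auto intro!: card_mono)
    with sur have "card ` S = {..card E}" by blast
    then have "card S = Suc (card E)" using card_image[OF inj] by simp
    then have "chain_of_length K (card E) S"
      using SK lin by (simp add: chain_of_length_def chain_less_iff)
    then show ?thesis by (auto simp: star_def)
  qed
  have starE: "\<exists>S. chain_of_length K (card E) S \<and> X \<in> S" if "X \<in> star E K" for X
    using that by (auto simp: star_def)
  have sub: "star E K \<subseteq> K" using chainD(1) by (auto simp: star_def)
  obtain S where S: "chain_of_length K (card E) S" using ex by blast
  have "{} \<in> star E K"
  proof -
    obtain X where "X \<in> S" "card X = 0" using chainD(3)[OF S] by (metis atMost_iff imageE zero_le)
    moreover from this have "X = {}" using chainD(1)[OF S] E by (metis PowD card_0_eq finite_subset subsetD)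
    ultimately show ?thesis using S by (auto simp: star_def)
  qed
  moreover have "E \<in> star E K"
  proof -
    obtain X where "X \<in> S" "card X = card E" using chainD(3)[OF S] by (metis atMost_iff imageE order_refl)
    moreover from this have "X = E" using chainD(1)[OF S] E by (metis PowD card_subset_eq subsetD)
    ultimately show ?thesis using S by (auto simp: star_def)
  qed
  moreover have "X \<union> Y \<in> star E K" if X: "X \<in> star E K" and Y: "Y \<in> star E K" for X Y
  proof -
    obtain S where S: "chain_of_length K (card E) S" "X \<in> S" using starE[OF X] by blast
    obtain T where T: "chain_of_length K (card E) T" "Y \<in> T" using starE[OF Y] by blast
    let ?U = "{Z \<in> S. Z \<subseteq> X} \<union> (\<lambda>Z. X \<union> Z) ` T"
    have "?U \<subseteq> K" using chainD(1)[OF S(1)] chainD(1)[OF T(1)] E(3) S(2) by blast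
    moreover have "A \<subseteq> B \<or> B \<subseteq> A" if "A \<in> ?U" "B \<in> ?U" for A B
      using that chainD(2)[OF S(1)] chainD(2)[OF T(1)] by blast
    moreover have "{..card E} \<subseteq> card ` ?U"
    proof
      fix k assume k: "k \<in> {..card E}"
      show "k \<in> card ` ?U"
      proof (cases "k \<le> card X")
        case True
        then obtain Z where Z: "Z \<in> S" "card Z = k"
          using chainD(3)[OF S(1)] k by (metis imageE)
        have "X \<in> K" "Z \<in> K" using chainD(1)[OF S(1)] S(2) Z(1) by auto
        then have "finite X" "finite Z" using E by (meson PowD finite_subset subsetD)+
        then have "Z \<subseteq> X"
          using chainD(2)[OF S(1) Z(1) S(2)] card_seteq[of Z X] Z(2) True by auto
        then show ?thesis using Z by blast
      next
        case False
        have TE: "Z \<subseteq> E" "finite Z" if "Z \<in> T" for Z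
          using that chainD(1)[OF T(1)] E by (meson PowD finite_subset subsetD)+
        have XE: "X \<subseteq> E" using S chainD(1) E by blast
        obtain Z0 where "Z0 \<in> T" "card Z0 = 0"
          using chainD(3)[OF T(1)] by (metis atMost_iff imageE zero_le)
        then have Z0: "Z0 \<in> T \<and> card (X \<union> Z0) \<le> k" using TE[of Z0] False by simp
        have "\<forall>Z. Z \<in> T \<and> card (X \<union> Z) \<le> k \<longrightarrow> card Z < Suc (card E)"
          using TE E(1) by (auto simp: less_Suc_eq_le intro: card_mono)
        \<comment> \<open>Take the largest \<open>Z\<close> in \<open>T\<close> with
          \<open>card (X \<union> Z) \<le> k\<close>. The next member of \<open>T\<close> adds one
          element and pushes the union beyond \<open>k\<close>, so the size \<open>k\<close> is not
          skipped.\<close>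
        from ex_has_greatest_nat[of "\<lambda>Z. Z \<in> T \<and> card (X \<union> Z) \<le> k", OF Z0 this]
        obtain Z where Z: "Z \<in> T" "card (X \<union> Z) \<le> k"
          and max: "\<And>Z'. Z' \<in> T \<Longrightarrow> card (X \<union> Z') \<le> k \<Longrightarrow> card Z' \<le> card Z" by blast
        have "k \<le> card (X \<union> Z)"
        proof (cases "card Z = card E")
          case True
          then have "Z = E" using TE[OF Z(1)] E(1) by (simp add: card_subset_eq)
          then have "X \<union> Z = E" using XE by blast
          then show ?thesis using k by simp
        next
          case False
          moreover have "card Z \<le> card E" using TE[OF Z(1)] E(1) by (simp add: card_mono)
          ultimately have "Suc (card Z) \<in> card ` T" using chainD(3)[OF T(1)] by simp
          then obtain Z' where Z': "Z' \<in> T" "card Z' = Suc (card Z)" by force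
          have "Z \<subseteq> Z'"
            using chainD(2)[OF T(1) Z(1) Z'(1)] card_mono[OF TE(2)[OF Z(1)], of Z'] Z'(2) by auto
          then have "card (Z' - Z) = 1" using Z'(2) TE(2)[OF Z(1)] by (simp add: card_Diff_subset)
          then obtain e where "Z' - Z = {e}" by (auto simp: card_1_singleton_iff)
          then have "X \<union> Z' = insert e (X \<union> Z)" using \<open>Z \<subseteq> Z'\<close> by auto
          then have "card (X \<union> Z') \<le> Suc (card (X \<union> Z))" by (metis card_insert_if card.infinite le_SucI order_refl zero_le finite_insert)
          moreover have "k < card (X \<union> Z')" using max[OF Z'(1)] Z'(2) by force
          ultimately show ?thesis by simp
        qed
        then show ?thesis using Z by (metis (no_types, lifting) UnI2 image_iff le_antisym)
      qed
    qed
    ultimately have "?U \<subseteq> star E K" by (rule chainI)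
    then show ?thesis using T(2) by blast
  qed
  moreover have "\<exists>e\<in>X. X - {e} \<in> star E K" if X: "X \<in> star E K" "X \<noteq> {}" for X
  proof -
    obtain S where S: "chain_of_length K (card E) S" "X \<in> S" using starE[OF X(1)] by blast
    have "X \<subseteq> E" using S chainD(1) E by blast
    then have "finite X" using E finite_subset by blast
    then have "0 < card X" using X(2) by (simp add: card_gt_0_iff)
    have "card X \<le> card E" using \<open>X \<subseteq> E\<close> E by (simp add: card_mono)
    \<comment> \<open>The member of the chain with one element fewer is contained in
      \<open>X\<close>, so it is \<open>X\<close> without a single element.\<close>
    then have "card X - 1 \<in> card ` S" using chainD(3)[OF S(1)] by auto
    then obtain Y where Y: "Y \<in> S" "card Y = card X - 1" by force
    have "finite Y" using chainD(1)[OF S(1)] Y(1) E by (meson PowD finite_subset subsetD)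
    have "Y \<subseteq> X"
      using chainD(2)[OF S(1) Y(1) S(2)] card_mono[OF \<open>finite Y\<close>, of X] Y(2) \<open>0 < card X\<close> by auto
    then have "card (X - Y) = 1"
      using Y(2) \<open>0 < card X\<close> \<open>finite Y\<close> by (simp add: card_Diff_subset)
    then obtain e where "X - Y = {e}" by (auto simp: card_1_singleton_iff)
    then have "e \<in> X" "X - {e} = Y" using \<open>Y \<subseteq> X\<close> by auto
    then show ?thesis using Y(1) S(1) by (auto simp: star_def)
  qed
  ultimately show ?thesis using E sub unfolding antimatroid_def by blast
qed

subsection \<open>Inversions and shortest galleries\<close>

text \<open>Along a flag the absorbed sets grow by one index at a time and spell a permutation. For
  a flag \<open>S\<close> these are its inversions: the larger letter \<open>b\<close> is read
  before \<open>a\<close>.\<close>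

definition inversions :: "'a::finite_rank_lattice set \<Rightarrow> 'a set \<Rightarrow> (nat \<times> nat) set" where
  "inversions C S = {(a, b). a \<in> {1..rank (top :: 'a)} \<and> a < b \<and>
     (\<exists>p\<in>S. b \<in> absorbed C p \<and> a \<notin> absorbed C p)}"

lemma inversions_subset:
  "inversions C S \<subseteq> {1..rank (top :: 'a)} \<times> {1..rank (top :: 'a)}"
  for S :: "'a::finite_rank_lattice set"
  unfolding inversions_def using absorbed_subset[of C] by blast

lemma finite_inversions [simp]: "finite (inversions C S)"
  by (rule finite_subset[OF inversions_subset]) simp

lemma inversions_self:
  fixes C :: "'a::semimodular_lattice set"
  assumes "flag C"
  shows "inversions C C = {}"
proof -
  have "a \<in> absorbed C p" if "p \<in> C" "b \<in> absorbed C p" "a < b" "1 \<le> a" for a b p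
  proof -
    have "absorbed C p = {1..rank p}"
      using absorbed_level[OF assms rank_le_top, of p] level_rank[OF assms that(1)] by simp
    then show ?thesis using that by simp
  qed
  then show ?thesis by (auto simp: inversions_def)
qed

lemma absorbed_insert:
  fixes C :: "'a::semimodular_lattice set"
  assumes "flag C" "p \<le> q" "rank q = Suc (rank p)" "a \<in> absorbed C q" "a \<notin> absorbed C p"
  shows "absorbed C q = insert a (absorbed C p)"
  using assms absorbed_mono[OF assms(2), of C] by (intro absorbed_eqI) (simp_all add: card_absorbed)

lemma absorbed_insertE:
  fixes C :: "'a::semimodular_lattice set"
  assumes "flag C" "p \<le> q" "rank q = Suc (rank p)"
  obtains a where "a \<notin> absorbed C p" "absorbed C q = insert a (absorbed C p)"
proof -
  have "\<not> absorbed C q \<subseteq> absorbed C p"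
    using card_mono[OF finite_absorbed, of "absorbed C q" C p] assms by (auto simp: card_absorbed)
  then obtain a where "a \<in> absorbed C q" "a \<notin> absorbed C p" by blast
  then show ?thesis using absorbed_insert[OF assms] that by blast
qed

lemma adjacent_sym: "adjacent F G \<Longrightarrow> adjacent G F"
  by (simp add: adjacent_def Int_commute)

text \<open>The one element of \<open>F\<close> outside \<open>G\<close> is neither
  \<open>bot\<close> nor \<open>top\<close>, since these lie in every flag.\<close>

lemma adjacentE:
  fixes F G :: "'a::semimodular_lattice set"
  assumes "adjacent F G"
  obtains k where "0 < k" "k < rank (top :: 'a)"
    "\<forall>j\<le>rank (top :: 'a). j \<noteq> k \<longrightarrow> level G j = level F j"
proof -
  let ?n = "rank (top :: 'a)"
  have F: "flag F" and G: "flag G" and card: "card (F \<inter> G) = ?n"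
    using assms by (auto simp: adjacent_def)
  have "card (F - G) = 1"
    using card_flag[OF F] card finite_flag[OF F] by (simp add: card_Diff_subset_Int)
  then obtain x where x: "F - G = {x}" by (auto simp: card_1_singleton_iff)
  have eq: "level G j = level F j" if j: "j \<le> ?n" "j \<noteq> rank x" for j
  proof -
    have "level F j \<noteq> x" using rank_level[OF F j(1)] j(2) by metis
    then have "level F j \<in> G" using level_in[OF F j(1)] x by blast
    then show ?thesis using level_rank[OF G] rank_level[OF F j(1)] by metis
  qed
  have "x \<noteq> bot" "x \<noteq> top" using x bot_in_flag[OF G] top_in_flag[OF G] by blast+
  then have "0 < rank x" "rank x < ?n"
    using rank_less[of bot x] rank_less[of x top] by (auto simp: bot.not_eq_extremum top.not_eq_extremum)
  then show ?thesis using eq by (intro that) auto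
qed

text \<open>An inversion lost in \<open>G\<close> can be certified only by the level that changes.
  The levels \<open>k - 1\<close> and \<open>Suc k\<close> are shared with \<open>G\<close>, so in
  \<open>F\<close> the letter \<open>b\<close> enters exactly at level \<open>k\<close> and
  \<open>a\<close> right after it.\<close>

lemma inversions_exchange:
  fixes C F G :: "'a::semimodular_lattice set"
  assumes C: "flag C" and F: "flag F" and G: "flag G" and k: "0 < k" "k < rank (top :: 'a)"
    and eq: "\<forall>j\<le>rank (top :: 'a). j \<noteq> k \<longrightarrow> level G j = level F j"
    and ab: "(a, b) \<in> inversions C F" "(a, b) \<notin> inversions C G"
  shows "a \<notin> absorbed C (level F k)"
    and "absorbed C (level F (Suc k)) = insert a (absorbed C (level F k))"
    and "b \<notin> absorbed C (level F (k - 1))"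
    and "absorbed C (level F k) = insert b (absorbed C (level F (k - 1)))"
proof -
  obtain p where p: "p \<in> F" "b \<in> absorbed C p" "a \<notin> absorbed C p"
    using ab(1) by (auto simp: inversions_def)
  have notG: "\<not> (b \<in> absorbed C q \<and> a \<notin> absorbed C q)" if "q \<in> G" for q
    using ab that by (auto simp: inversions_def)
  have "rank p = k"
  proof (rule ccontr)
    assume "rank p \<noteq> k"
    then have "p = level G (rank p)" using eq rank_le_top[of p] level_rank[OF F p(1)] by simp
    then have "p \<in> G" using level_in[OF G rank_le_top] by metis
    then show False using notG p by blast
  qed
  then have p_eq: "p = level F k" using level_rank[OF F p(1)] by simp
  have in_G: "level F (k - 1) \<in> G" "level F (Suc k) \<in> G"
    using eq level_in[OF G, of "k - 1"] level_in[OF G, of "Suc k"] k by auto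
  have le: "level F (k - 1) \<le> level F k" "level F k \<le> level F (Suc k)"
    using k by (auto intro: level_mono[OF F])
  show a: "a \<notin> absorbed C (level F k)" using p p_eq by simp
  have b: "b \<in> absorbed C (level F k)" using p p_eq by simp
  show b': "b \<notin> absorbed C (level F (k - 1))"
    using notG[OF in_G(1)] a absorbed_mono[OF le(1), of C] by blast
  have a': "a \<in> absorbed C (level F (Suc k))"
    using notG[OF in_G(2)] b absorbed_mono[OF le(2), of C] by blast
  show "absorbed C (level F (Suc k)) = insert a (absorbed C (level F k))"
    using k by (intro absorbed_insert C le a a') (simp add: rank_level[OF F])
  show "absorbed C (level F k) = insert b (absorbed C (level F (k - 1)))"
    using k by (intro absorbed_insert C le b b') (simp add: rank_level[OF F])
qed

text \<open>By \<open>inversions_exchange\<close>, a lost inversion consists of the letters that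
  enter \<open>F\<close> at levels \<open>Suc k\<close> and \<open>k\<close>, so at most one is
  lost.\<close>

lemma card_inversions_adjacent:
  fixes C :: "'a::semimodular_lattice set"
  assumes C: "flag C" and "adjacent F G"
  shows "card (inversions C F) \<le> Suc (card (inversions C G))"
proof -
  have F: "flag F" and G: "flag G" using assms(2) by (auto simp: adjacent_def)
  obtain k where k: "0 < k" "k < rank (top :: 'a)"
    "\<forall>j\<le>rank (top :: 'a). j \<noteq> k \<longrightarrow> level G j = level F j"
    using assms(2) by (rule adjacentE)
  note exch = inversions_exchange[OF C F G k]
  have unique: "x = y" if "x \<in> inversions C F - inversions C G" "y \<in> inversions C F - inversions C G" for x y
  proof -
    obtain a b a' b' where xy: "x = (a, b)" "y = (a', b')" by (metis surj_pair)
    then have x: "(a, b) \<in> inversions C F" "(a, b) \<notin> inversions C G"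
      and y: "(a', b') \<in> inversions C F" "(a', b') \<notin> inversions C G" using that by auto
    have "a = a'" using exch(1,2)[OF x] exch(1,2)[OF y] by (metis insertE insertI1)
    moreover have "b = b'" using exch(3,4)[OF x] exch(3,4)[OF y] by (metis insertE insertI1)
    ultimately show ?thesis by (simp add: xy)
  qed
  have "card (inversions C F - inversions C G) \<le> Suc 0"
    using unique by (simp add: card_le_Suc0_iff_eq)
  moreover have "card (inversions C F) \<le> card (inversions C G \<union> (inversions C F - inversions C G))"
    by (rule card_mono) auto
  then have "card (inversions C F) \<le> card (inversions C G) + card (inversions C F - inversions C G)"
    using card_Un_le le_trans by blast
  ultimately show ?thesis by simp
qed

section \<open>Walks and the distance from \<open>C\<close>\<close>

text \<open>A gallery without distinctness, so that walks concatenate freely; walks of minimal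
  length turn out distinct in \<open>tight_walk\<close>.\<close>

definition walk :: "'a::finite_rank_lattice set \<Rightarrow> 'a set \<Rightarrow> 'a set list \<Rightarrow> bool" where
  "walk C D Fs \<longleftrightarrow> Fs \<noteq> [] \<and> hd Fs = C \<and> last Fs = D \<and> (\<forall>F\<in>set Fs. flag F) \<and>
     successively adjacent Fs"

lemma gallery_iff_walk: "gallery C D Fs \<longleftrightarrow> walk C D Fs \<and> distinct Fs"
  by (auto simp: gallery_def walk_def)

lemma walk_snoc:
  "walk C D (Fs @ [E]) \<longleftrightarrow> E = D \<and> flag D \<and>
     (if Fs = [] then C = D else walk C (last Fs) Fs \<and> adjacent (last Fs) D)"
  by (auto simp: walk_def successively_append_iff)

lemma walk_append:
  "walk C F Fs \<Longrightarrow> walk F D Gs \<Longrightarrow> walk C D (Fs @ tl Gs)"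
  by (cases Gs) (auto simp: walk_def successively_append_iff successively_Cons last_append split: if_splits)

text \<open>There are no inversions at \<open>C\<close> and each step adds at most one. The
  inequality is strict because \<open>length\<close> counts flags, not steps.\<close>

lemma card_inversions_less_length_walk:
  fixes C D :: "'a::semimodular_lattice set"
  assumes "flag C" "walk C D Fs"
  shows "card (inversions C D) < length Fs"
  using assms(2)
proof (induction Fs arbitrary: D rule: rev_induct)
  case Nil
  then show ?case by (simp add: walk_def)
next
  case (snoc E Fs)
  show ?case
  proof (cases "Fs = []")
    case True
    then have "C = D" using snoc.prems walk_snoc[of C D "[]" E] by simp
    then show ?thesis using inversions_self[OF assms(1)] by simp
  next
    case False
    then have "walk C (last Fs) Fs" "adjacent D (last Fs)"
      using snoc.prems by (auto simp: walk_snoc intro: adjacent_sym)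
    then show ?thesis using snoc.IH card_inversions_adjacent[OF assms(1)] by fastforce
  qed
qed

text \<open>If \<open>t\<close> is the first level where the flags differ, then pushing \<open>level C t\<close> one step
  down in \<open>D\<close> removes one inversion. An arbitrary descent of \<open>D\<close> need not admit an exchange.\<close>

lemma ex_adjacent_fewer_inversions:
  fixes C D :: "'a::semimodular_lattice set"
  assumes C: "flag C" and D: "flag D" and "C \<noteq> D"
  shows "\<exists>D'. adjacent D' D \<and> inversions C D' \<subset> inversions C D"
proof -
  let ?n = "rank (top :: 'a)"
  have "\<exists>t\<le>?n. level C t \<noteq> level D t"
  proof (rule ccontr)
    assume "\<not> (\<exists>t\<le>?n. level C t \<noteq> level D t)"
    then have *: "level C j = level D j" if "j \<le> ?n" for j using that by blast
    have "x \<in> D" if "x \<in> C" for x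
      using *[OF rank_le_top] level_rank[OF C that] level_in[OF D rank_le_top] by metis
    moreover have "x \<in> C" if "x \<in> D" for x
      using *[OF rank_le_top] level_rank[OF D that] level_in[OF C rank_le_top] by metis
    ultimately show False using \<open>C \<noteq> D\<close> by blast
  qed
  then obtain t0 where "t0 \<le> ?n" "level C t0 \<noteq> level D t0" by blast
  moreover have "\<not> level C 0 \<noteq> level D 0" by (simp add: level_0 C D)
  ultimately obtain s where s: "s < t0" "\<And>i. i \<le> s \<Longrightarrow> level C i = level D i"
      "level C (Suc s) \<noteq> level D (Suc s)"
    using ex_least_nat_less[of "\<lambda>t. level C t \<noteq> level D t" t0] by blast
  have sn: "Suc s \<le> ?n" using s(1) \<open>t0 \<le> ?n\<close> by simp
  let ?c = "level C (Suc s)"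
  have "?c \<le> level D ?n" by (simp add: level_top D)
  then obtain m where m: "m \<le> ?n" "\<And>i. i < m \<Longrightarrow> \<not> ?c \<le> level D i" "?c \<le> level D m"
    \<comment> \<open>At level \<open>m\<close> the flag \<open>D\<close> first rises above
      \<open>?c\<close>. As \<open>m\<close> exceeds \<open>Suc s\<close>, the first level where the
      flags differ, \<open>?c\<close> can be pushed down into level \<open>m - 1\<close>.\<close>
    using ex_least_nat_le[of "\<lambda>i. ?c \<le> level D i" ?n] by blast
  have "Suc s < m"
  proof (rule ccontr)
    assume "\<not> Suc s < m"
    then have "level D m \<le> level D (Suc s)" using sn by (intro level_mono D) auto
    then have "?c \<le> level D (Suc s)" using m(3) by simp
    then have "?c = level D (Suc s)" using sn by (intro eq_if_le_rank) (simp_all add: rank_level C D)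
    then show False using s(3) by simp
  qed
  then obtain k where k: "m = Suc (Suc k)" "s \<le> k"
    by (metis Suc_le_D Suc_le_eq less_Suc_eq_le)
  have kn: "Suc (Suc k) \<le> ?n" using k m by simp
  let ?d = "level D k" and ?e = "level D (Suc k)" and ?f = "level D (Suc (Suc k))"
  let ?x = "sup ?c ?d"
  have "\<not> ?c \<le> ?d" "\<not> ?c \<le> ?e" using m(2) k by auto
  have "level C s \<le> ?d" using s(2)[of s] k kn by (auto intro: level_mono[OF D])
  have "rank ?x \<le> Suc (rank (sup (level C s) ?d))"
    using sn by (intro rank_sup_le_Suc level_mono[OF C]) (simp_all add: rank_level C)
  then have "rank ?x \<le> Suc k" using \<open>level C s \<le> ?d\<close> kn by (simp add: sup.absorb2 rank_level D)
  moreover have "?d < ?x"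
    using \<open>\<not> ?c \<le> ?d\<close> by (metis order.order_iff_strict sup.cobounded1 sup.cobounded2)
  then have "k < rank ?x" using rank_less[of ?d ?x] kn by (simp add: rank_level D)
  ultimately have rx: "rank ?x = Suc k" by simp
  have "?x \<le> ?f" using m(3) k kn by (auto intro: level_mono[OF D])
  have "?x \<notin> D"
  proof
    assume "?x \<in> D"
    then have "?x = ?e" using level_rank[OF D] rx by metis
    then show False using \<open>\<not> ?c \<le> ?e\<close> by (metis sup.cobounded1)
  qed
  \<comment> \<open>Both \<open>?e\<close> and \<open>?x\<close> have rank \<open>Suc k\<close> and
    lie between \<open>?d\<close> and \<open>?f\<close>, so the exchange yields a chain of the same
    size.\<close>
  let ?D' = "insert ?x (D - {?e})"
  have "?e \<in> D" using kn by (intro level_in D) simp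
  have split: "w \<le> ?d \<or> ?f \<le> w" if "w \<in> D - {?e}" for w
  proof -
    have "rank w \<noteq> Suc k" using that level_rank[OF D, of w] by auto
    then consider "rank w \<le> k" | "Suc (Suc k) \<le> rank w" by linarith
    then show ?thesis
    proof cases
      case 1
      then have "level D (rank w) \<le> ?d" using kn by (intro level_mono D) auto
      then show ?thesis using that level_rank[OF D] by simp
    next
      case 2
      then have "?f \<le> level D (rank w)" by (intro level_mono D rank_le_top)
      then show ?thesis using that level_rank[OF D] by simp
    qed
  qed
  have "pred_on.chain UNIV (<) ?D'"
    unfolding chain_less_iff
  proof (intro conjI ballI subset_UNIV)
    have x: "w \<le> ?x \<or> ?x \<le> w" if "w \<in> D - {?e}" for w
      using split[OF that] \<open>?d < ?x\<close> \<open>?x \<le> ?f\<close> by (meson less_imp_le order_trans)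
    fix u v assume "u \<in> ?D'" "v \<in> ?D'"
    then show "u \<le> v \<or> v \<le> u" using x flag_linear[OF D] by blast
  qed
  moreover have "card ?D' = Suc ?n"
    using \<open>?x \<notin> D\<close> \<open>?e \<in> D\<close> finite_flag[OF D] card_flag[OF D] by simp
  ultimately have D': "flag ?D'" by (simp add: flag_iff_chain_of_length chain_of_length_def)
  have "?D' \<inter> D = D - {?e}" using \<open>?x \<notin> D\<close> by auto
  then have "adjacent ?D' D"
    using D D' \<open>?e \<in> D\<close> card_flag[OF D] finite_flag[OF D] by (simp add: adjacent_def)
  have t_e: "Suc s \<notin> absorbed C ?e" and t_d: "Suc s \<notin> absorbed C ?d"
  proof -
    have "level C s \<le> ?e" using \<open>level C s \<le> ?d\<close> level_mono[OF D, of k "Suc k"] kn by simp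
    then show "Suc s \<notin> absorbed C ?e" "Suc s \<notin> absorbed C ?d"
      using \<open>level C s \<le> ?d\<close> \<open>\<not> ?c \<le> ?d\<close> \<open>\<not> ?c \<le> ?e\<close> by (simp_all add: absorbed_def sup.absorb2)
  qed
  have t_c: "Suc s \<in> absorbed C ?c" using absorbed_level[OF C sn] by simp
  then have t_x: "Suc s \<in> absorbed C ?x" using absorbed_mono[of ?c ?x C] by auto
  have ax: "absorbed C ?x = insert (Suc s) (absorbed C ?d)"
    using C \<open>?d < ?x\<close> rx t_x t_d kn by (intro absorbed_insert) (simp_all add: rank_level D)
  have "?d \<le> ?e" "rank ?e = Suc (rank ?d)"
    using kn by (auto intro: level_mono[OF D] simp: rank_level D)
  \<comment> \<open>\<open>D\<close> reads \<open>r\<close> at level \<open>Suc k\<close>, just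
    before \<open>Suc s\<close>. As \<open>?d\<close> absorbs all of \<open>{1..s}\<close>, the
    letter \<open>r\<close> is larger than \<open>Suc s\<close>, and this inversion
    disappears.\<close>
  then obtain r where r: "r \<notin> absorbed C ?d" "absorbed C ?e = insert r (absorbed C ?d)"
    by (rule absorbed_insertE[OF C])
  have low: "{1..s} \<subseteq> absorbed C ?d"
    using absorbed_mono[OF \<open>level C s \<le> ?d\<close>, of C] absorbed_level[OF C, of s] sn by simp
  have "r \<in> {1..?n}" using r absorbed_subset by blast
  then have "\<not> r \<le> s" using low r(1) by auto
  moreover have "r \<noteq> Suc s" using r(2) t_e by blast
  ultimately have "Suc s < r" by linarith
  have dD: "?d \<in> D" using kn by (intro level_in D) simp
  have "inversions C ?D' \<subseteq> inversions C D"
  proof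
    fix z assume "z \<in> inversions C ?D'"
    then obtain a b p where z: "z = (a, b)" "a \<in> {1..?n}" "a < b" "p \<in> ?D'"
        "b \<in> absorbed C p" "a \<notin> absorbed C p"
      by (auto simp: inversions_def)
    have "\<exists>p\<in>D. b \<in> absorbed C p \<and> a \<notin> absorbed C p"
    proof (cases "p = ?x")
      case True
      \<comment> \<open>Here \<open>a > s\<close>, hence \<open>b\<close> is not the new letter
        \<open>Suc s\<close>, and \<open>?d\<close> in \<open>D\<close> already certifies the
        inversion.\<close>
      then have "a \<notin> absorbed C ?d" using z ax by blast
      then have "\<not> a \<le> s" using low z(2) by auto
      then have "b \<in> absorbed C ?d" using z(3,5) True ax by auto
      then show ?thesis using \<open>a \<notin> absorbed C ?d\<close> dD by blast
    qed (use z in auto)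
    then show "z \<in> inversions C D" using z by (simp add: inversions_def)
  qed
  moreover have "(Suc s, r) \<in> inversions C D"
    using \<open>Suc s < r\<close> sn r t_e \<open>?e \<in> D\<close> by (auto simp: inversions_def)
  moreover have "(Suc s, r) \<notin> inversions C ?D'"
  proof
    assume "(Suc s, r) \<in> inversions C ?D'"
    then obtain p where p: "p \<in> ?D'" "r \<in> absorbed C p" "Suc s \<notin> absorbed C p"
      by (auto simp: inversions_def)
    then have "p \<noteq> ?x" using t_x by blast
    then have "p \<le> ?d \<or> ?f \<le> p" using split p(1) by blast
    then show False
    proof
      assume "p \<le> ?d"
      then show False using p(2) r(1) absorbed_mono[of p ?d C] by blast
    next
      assume "?f \<le> p"
      then have "?c \<le> p" using m(3) k(1) by simp
      then show False using p(3) t_c absorbed_mono[of ?c p C] by blast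
    qed
  qed
  ultimately show ?thesis using \<open>adjacent ?D' D\<close> by blast
qed

text \<open>Each backward step from \<open>D\<close> given by
  \<open>ex_adjacent_fewer_inversions\<close> removes an inversion, and adjacency allows only one to
  go in the count, so the lower bound is attained.\<close>

lemma ex_walk:
  fixes C D :: "'a::semimodular_lattice set"
  assumes C: "flag C" and "flag D"
  shows "\<exists>Fs. walk C D Fs \<and> length Fs = Suc (card (inversions C D))"
  using assms(2)
proof (induction "card (inversions C D)" arbitrary: D rule: less_induct)
  case less
  show ?case
  proof (cases "C = D")
    case True
    then have "walk C D [C]" "length [C] = Suc (card (inversions C D))"
      using C by (auto simp: walk_def inversions_self)
    then show ?thesis by blast
  next
    case False
    then obtain D' where D': "adjacent D' D" "inversions C D' \<subset> inversions C D"
      using ex_adjacent_fewer_inversions[OF C less.prems] by blast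
    then have lt: "card (inversions C D') < card (inversions C D)"
      by (intro psubset_card_mono) simp_all
    have "flag D'" using D'(1) by (simp add: adjacent_def)
    then obtain Fs where Fs: "walk C D' Fs" "length Fs = Suc (card (inversions C D'))"
      using less.hyps[OF lt] by blast
    then have "walk C D (Fs @ [D])"
      using D'(1) less.prems unfolding walk_snoc by (auto simp: walk_def)
    moreover have "card (inversions C D) \<le> Suc (card (inversions C D'))"
      using card_inversions_adjacent[OF C adjacent_sym[OF D'(1)]] .
    then have "length (Fs @ [D]) = Suc (card (inversions C D))" using lt Fs(2) by simp
    ultimately show ?thesis by blast
  qed
qed

section \<open>Shortest galleries stay in the twin hull\<close>

text \<open>Only the exchanged element \<open>?x\<close> needs witnesses. Indices not absorbed by
  \<open>?f\<close> take \<open>?f\<close>; the one remaining index \<open>b\<close> takes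
  \<open>?d\<close>.\<close>

lemma adjacent_subset_twin_hull:
  fixes C D :: "'a::semimodular_lattice set"
  assumes C: "flag C" and adj: "adjacent D' D"
    and less: "card (inversions C D') < card (inversions C D)"
  shows "D' \<subseteq> twin_hull C D"
proof -
  let ?n = "rank (top :: 'a)"
  have D: "flag D" and D': "flag D'" using adj by (auto simp: adjacent_def)
  obtain k where k: "0 < k" "k < ?n" "\<forall>j\<le>?n. j \<noteq> k \<longrightarrow> level D' j = level D j"
    using adjacent_sym[OF adj] by (rule adjacentE)
  have "\<not> inversions C D \<subseteq> inversions C D'"
    using card_mono[OF finite_inversions, of "inversions C D" C D'] less by linarith
  then obtain a b where ab: "(a, b) \<in> inversions C D" "(a, b) \<notin> inversions C D'" by auto
  note exch = inversions_exchange[OF C D D' k ab]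
  let ?x = "level D' k" and ?d = "level D (k - 1)" and ?f = "level D (Suc k)"
  have "level D' (k - 1) = ?d" "level D' (Suc k) = ?f"
    using k by auto
  then have dx: "?d \<le> ?x" and xf: "?x \<le> ?f"
    using level_mono[OF D', of "k - 1" k] level_mono[OF D', of k "Suc k"] k(1,2) by auto
  have dD: "?d \<in> D" and fD: "?f \<in> D" using k by (auto intro: level_in[OF D])
  have rx: "rank ?x = Suc (rank ?d)" using k by (simp add: rank_level D D')
  have "?x \<in> D'" using k by (auto intro: level_in[OF D'])
  have "a < b" "a \<in> {1..?n}" using ab(1) by (auto simp: inversions_def)
  obtain c where c: "c \<notin> absorbed C ?d" "absorbed C ?x = insert c (absorbed C ?d)"
    using absorbed_insertE[OF C dx rx] .
  have "absorbed C ?x \<subseteq> insert a (insert b (absorbed C ?d))"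
    using absorbed_mono[OF xf, of C] exch by simp
  then have "c = a \<or> c = b" using c by blast
  \<comment> \<open>If \<open>b\<close> still entered first, \<open>(a, b)\<close> would remain an
    inversion of \<open>D'\<close>.\<close>
  moreover have "c \<noteq> b"
  proof
    assume "c = b"
    then have "b \<in> absorbed C ?x" using c by blast
    moreover have "a \<notin> absorbed C ?x" using c \<open>c = b\<close> exch(1,4) by blast
    ultimately show False
      using ab(2) \<open>?x \<in> D'\<close> \<open>a < b\<close> \<open>a \<in> {1..?n}\<close> by (auto simp: inversions_def)
  qed
  ultimately have ax: "a \<notin> absorbed C ?d" "absorbed C ?x = insert a (absorbed C ?d)" using c by auto
  \<comment> \<open>Over \<open>?y\<close>, joining \<open>level C a\<close> raises the rank and
    joining \<open>?x\<close> raises it by at most one. The first join is below the second, so they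
    agree.\<close>
  have le_a: "?x \<le> sup (level C a) ?d"
  proof -
    let ?y = "sup (level C (a - 1)) ?d"
    have "level C a \<le> sup (level C (a - 1)) ?x" using ax(2) by (auto simp: absorbed_def)
    also have "\<dots> \<le> sup ?x ?y" by (simp add: le_supI1 le_supI2)
    finally have ay: "sup (level C a) ?y \<le> sup ?x ?y" by simp
    have "\<not> level C a \<le> ?y" using ax(1) \<open>a \<in> {1..?n}\<close> by (simp add: absorbed_def)
    then have "?y < sup (level C a) ?y"
      by (metis order.order_iff_strict sup.cobounded1 sup.cobounded2)
    then have "rank ?y < rank (sup (level C a) ?y)" by (rule rank_less)
    moreover have "rank (sup ?x ?y) \<le> Suc (rank (sup ?d ?y))"
      using dx rx by (intro rank_sup_le_Suc) simp_all
    then have "rank (sup ?x ?y) \<le> Suc (rank ?y)" by (simp add: sup.absorb2)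
    ultimately have "sup (level C a) ?y = sup ?x ?y" using ay by (intro eq_if_le_rank) simp_all
    then have "?x \<le> sup (level C a) ?y" by (metis sup.cobounded1)
    moreover have "level C (a - 1) \<le> level C a"
      using \<open>a \<in> {1..?n}\<close> by (intro level_mono C) auto
    then have "sup (level C a) ?y = sup (level C a) ?d"
      by (simp add: sup.assoc[symmetric] sup.absorb1)
    ultimately show ?thesis by simp
  qed
  have b: "b \<in> {1..?n}" using exch(4) absorbed_subset by blast
  have xH: "?x \<in> twin_hull C D"
    unfolding twin_hull_def mem_Collect_eq
  proof
    fix i assume i: "i \<in> {1..?n} - absorbed C ?x"
    show "\<exists>d\<in>D. i \<notin> absorbed C d \<and> ?x \<le> sup (level C (i - 1)) d"
    proof (cases "i \<in> absorbed C ?f")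
      case False
      then show ?thesis using fD xf by (intro bexI[of _ ?f]) (auto intro: le_supI2)
    next
      case True
      then have "i = b" using i exch ax by auto
      have "level C a \<le> level C (b - 1)" using \<open>a < b\<close> b by (intro level_mono C) auto
      then have "?x \<le> sup (level C (b - 1)) ?d"
        using le_a by (meson order_refl order_trans sup_mono)
      then show ?thesis using \<open>i = b\<close> exch(3) dD by blast
    qed
  qed
  show ?thesis
  proof
    fix p assume p: "p \<in> D'"
    show "p \<in> twin_hull C D"
    proof (cases "rank p = k")
      case True
      then show ?thesis using level_rank[OF D' p] xH by simp
    next
      case False
      then have "p = level D (rank p)" using k(3) rank_le_top[of p] level_rank[OF D' p] by simp
      then have "p \<in> D" using level_in[OF D rank_le_top] by metis
      then show ?thesis using flags_subset_twin_hull[OF C D] by blast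
    qed
  qed
qed

text \<open>Tightness leaves no slack: every step adds one inversion, so no flag repeats, and
  \<open>adjacent_subset_twin_hull\<close> applies to each step.\<close>

lemma tight_walk:
  fixes C D :: "'a::semimodular_lattice set"
  assumes C: "flag C" and "walk C D Fs" "length Fs = Suc (card (inversions C D))"
  shows "distinct Fs \<and> (\<forall>F\<in>set Fs. card (inversions C F) \<le> card (inversions C D) \<and> F \<subseteq> twin_hull C D)"
  using assms(2,3)
proof (induction Fs arbitrary: D rule: rev_induct)
  case Nil
  then show ?case by (simp add: walk_def)
next
  case (snoc E Fs)
  have E: "E = D" and D: "flag D" using snoc.prems(1) by (auto simp: walk_snoc)
  have DH: "D \<subseteq> twin_hull C D" using flags_subset_twin_hull[OF C D] by simp
  show ?case
  proof (cases "Fs = []")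
    case True
    then show ?thesis using E DH by simp
  next
    case False
    let ?L = "last Fs"
    have w: "walk C ?L Fs" and adj: "adjacent ?L D" using False snoc.prems(1) by (auto simp: walk_snoc)
    have "card (inversions C ?L) < length Fs" using card_inversions_less_length_walk[OF C w] .
    moreover have "card (inversions C D) \<le> Suc (card (inversions C ?L))"
      using card_inversions_adjacent[OF C adjacent_sym[OF adj]] .
    ultimately have len: "length Fs = Suc (card (inversions C ?L))"
      and less: "card (inversions C ?L) < card (inversions C D)"
      using snoc.prems(2) by auto
    have L: "flag ?L" using adj by (simp add: adjacent_def)
    \<comment> \<open>Monotonicity of the twin hull comes from the minimality of
      \<open>mConv\<close> rather than from its own definition.\<close>
    have "C \<union> ?L \<subseteq> mConv (C \<union> D)"
      using adjacent_subset_twin_hull[OF C adj less] flags_subset_twin_hull[OF C D]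
      by (simp add: mConv_eq_twin_hull[OF C D])
    then have "mConv (C \<union> ?L) \<subseteq> mConv (C \<union> D)"
      using modular_convex_mConv by (rule mConv_least)
    then have sub: "twin_hull C ?L \<subseteq> twin_hull C D"
      by (simp add: mConv_eq_twin_hull C D L)
    have "card (inversions C F) < card (inversions C D) \<and> F \<subseteq> twin_hull C D" if "F \<in> set Fs" for F
      using snoc.IH[OF w len] that less sub by (meson le_less_trans order_trans)
    moreover from this have "D \<notin> set Fs" by blast
    ultimately show ?thesis using snoc.IH[OF w len] E DH by (simp add: less_imp_le)
  qed
qed

lemma shortest_gallery_iff:
  fixes C D :: "'a::semimodular_lattice set"
  assumes "flag C" "flag D"
  shows "shortest_gallery C D Fs \<longleftrightarrow> walk C D Fs \<and> length Fs = Suc (card (inversions C D))"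
proof -
  obtain Gs where Gs: "walk C D Gs" "length Gs = Suc (card (inversions C D))"
    using ex_walk[OF assms] by blast
  then have "gallery C D Gs" using tight_walk[OF assms(1)] by (simp add: gallery_iff_walk)
  moreover have "card (inversions C D) < length Hs" if "gallery C D Hs" for Hs
    using that card_inversions_less_length_walk[OF assms(1)] by (simp add: gallery_iff_walk)
  ultimately show ?thesis
    using Gs(2) tight_walk[OF assms(1), of D Fs] unfolding shortest_gallery_def is_arg_min_def
    by (metis gallery_iff_walk not_less_eq less_antisym)
qed

section \<open>Additivity of the distance through flags of the hull\<close>

text \<open>A witness \<open>d\<close> for \<open>a\<close> gives
  \<open>absorbed C p \<subseteq> {1..a - 1} \<union> absorbed C d\<close>. Since
  \<open>b > a\<close>, the element \<open>d\<close> absorbs \<open>b\<close> but not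
  \<open>a\<close>.\<close>

lemma inversions_subset_if_subset_twin_hull:
  fixes C D :: "'a::semimodular_lattice set"
  assumes C: "flag C" and D: "flag D" and F: "F \<subseteq> twin_hull C D"
  shows "inversions C F \<subseteq> inversions C D"
proof
  fix z assume "z \<in> inversions C F"
  then obtain a b p where z: "z = (a, b)" "a \<in> {1..rank (top :: 'a)}" "a < b" "p \<in> F"
      "b \<in> absorbed C p" "a \<notin> absorbed C p"
    by (auto simp: inversions_def)
  then obtain d where d: "d \<in> D" "a \<notin> absorbed C d" "p \<le> sup (level C (a - 1)) d"
    using twin_hullD[of p C D a] F by blast
  have le: "a - 1 \<le> rank (top :: 'a)" using z(2) by auto
  have H: "level C (a - 1) \<in> twin_hull C D" "d \<in> twin_hull C D"
    using flags_subset_twin_hull[OF C D] level_in[OF C le] d(1) by auto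
  then have "absorbed C p \<subseteq> {1..a - 1} \<union> absorbed C d"
    using absorbed_mono[OF d(3), of C] unfolding absorbed_sup[OF C D H] absorbed_level[OF C le] by blast
  then have "b \<in> absorbed C d" using z by auto
  then show "z \<in> inversions C D" using z d by (auto simp: inversions_def)
qed

text \<open>With \<open>u i\<close> the letter at position \<open>i\<close> of the permutation of \<open>F\<close>, the map \<open>(i, j) \<mapsto> (u i, u j)\<close> sends the
  inversions of \<open>D\<close> relative to \<open>F\<close> to those inversions of \<open>D\<close> that \<open>F\<close> lacks.\<close>

lemma card_inversions_add_le:
  fixes C D :: "'a::semimodular_lattice set"
  assumes C: "flag C" and D: "flag D" and F: "flag F" and FH: "F \<subseteq> twin_hull C D"
  shows "card (inversions C F) + card (inversions F D) \<le> card (inversions C D)"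
proof -
  let ?n = "rank (top :: 'a)"
  have "\<exists>a. a \<notin> absorbed C (level F (i - 1)) \<and>
      absorbed C (level F i) = insert a (absorbed C (level F (i - 1)))" if i: "i \<in> {1..?n}" for i
  proof -
    have "level F (i - 1) \<le> level F i" "rank (level F i) = Suc (rank (level F (i - 1)))"
      using i by (auto intro: level_mono[OF F] simp: rank_level F)
    then show ?thesis using absorbed_insertE[OF C] by blast
  qed
  then obtain u where u: "\<And>i. i \<in> {1..?n} \<Longrightarrow> u i \<notin> absorbed C (level F (i - 1))"
    "\<And>i. i \<in> {1..?n} \<Longrightarrow> absorbed C (level F i) = insert (u i) (absorbed C (level F (i - 1)))"
    by metis
  have u_iff: "u i \<in> absorbed C (level F k) \<longleftrightarrow> i \<le> k" if "i \<in> {1..?n}" "k \<le> ?n" for i k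
  proof (cases "i \<le> k")
    case True
    then have "absorbed C (level F i) \<subseteq> absorbed C (level F k)"
      using that by (intro absorbed_mono level_mono[OF F])
    then show ?thesis using u(2)[OF that(1)] True by blast
  next
    case False
    then have "absorbed C (level F k) \<subseteq> absorbed C (level F (i - 1))"
      using that by (intro absorbed_mono level_mono[OF F]) auto
    then show ?thesis using u(1)[OF that(1)] False by blast
  qed
  have u_range: "u i \<in> {1..?n}" if "i \<in> {1..?n}" for i
    using u(2)[OF that] absorbed_subset by blast
  have inH: "level F i \<in> twin_hull C D" if "i \<le> ?n" for i using level_in[OF F that] FH by blast
  \<comment> \<open>On the twin hull, order is inclusion of absorbed sets and join is union, so
    absorption relative to \<open>F\<close> becomes absorption relative to \<open>C\<close> after
    renaming \<open>i\<close> to \<open>u i\<close>.\<close>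
  have key: "i \<in> absorbed F d \<longleftrightarrow> u i \<in> absorbed C d" if i: "i \<in> {1..?n}" and d: "d \<in> D" for i d
  proof -
    have "i - 1 \<le> ?n" "i \<le> ?n" using i by auto
    have dH: "d \<in> twin_hull C D" using flags_subset_twin_hull[OF C D] d by blast
    note H = inH[OF \<open>i - 1 \<le> ?n\<close>]
    have "i \<in> absorbed F d \<longleftrightarrow> level F i \<le> sup (level F (i - 1)) d" using i by (simp add: absorbed_def)
    also have "\<dots> \<longleftrightarrow> absorbed C (level F i) \<subseteq> absorbed C (level F (i - 1)) \<union> absorbed C d"
      using absorbed_le_iff[OF C D inH[OF \<open>i \<le> ?n\<close>] sup_in_twin_hull[OF C D H dH]]
      unfolding absorbed_sup[OF C D H dH] by (rule sym)
    also have "\<dots> \<longleftrightarrow> u i \<in> absorbed C d" using u[OF i] by auto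
    finally show ?thesis .
  qed
  let ?g = "\<lambda>(i, j). (u i, u j)"
  have inj_u: "i = j" if "i \<in> {1..?n}" "j \<in> {1..?n}" "u i = u j" for i j
    using that u_iff[of i i] u_iff[of i j] u_iff[of j i] u_iff[of j j] by simp
  have range: "i \<in> {1..?n} \<and> j \<in> {1..?n}" if "(i, j) \<in> inversions F D" for i j
    using that inversions_subset[of F D] by blast
  have "inj_on ?g (inversions F D)"
  proof (rule inj_onI, clarify)
    fix i j i' j'
    assume "(i, j) \<in> inversions F D" "(i', j') \<in> inversions F D" "u i = u i'" "u j = u j'"
    then show "i = i' \<and> j = j'" using inj_u range by blast
  qed
  moreover have "?g ` inversions F D \<subseteq> inversions C D - inversions C F"
  proof (rule image_subsetI)
    fix z assume "z \<in> inversions F D"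
    then obtain i j d where z: "z = (i, j)" "i < j" "d \<in> D" "j \<in> absorbed F d" "i \<notin> absorbed F d"
      by (auto simp: inversions_def)
    then have ij: "i \<in> {1..?n}" "j \<in> {1..?n}" using range \<open>z \<in> inversions F D\<close> by blast+
    have d: "u j \<in> absorbed C d" "u i \<notin> absorbed C d" using key ij z by auto
    \<comment> \<open>Otherwise \<open>F\<close>, reading \<open>u i\<close> before
      \<open>u j\<close>, has the inversion \<open>(u j, u i)\<close>, and then so does
      \<open>D\<close>. But \<open>d\<close> shows that the chain \<open>D\<close> reads
      \<open>u j\<close> first.\<close>
    have "u i < u j"
    proof (rule ccontr)
      assume "\<not> u i < u j"
      then have "u j < u i" using d by (metis linorder_less_linear)
      moreover have "i \<le> ?n" using ij by simp
      then have "level F i \<in> F" "u i \<in> absorbed C (level F i)" "u j \<notin> absorbed C (level F i)"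
        using ij z(2) by (auto simp: u_iff intro: level_in[OF F])
      ultimately have "(u j, u i) \<in> inversions C F" using u_range[OF ij(2)] by (auto simp: inversions_def)
      then have "(u j, u i) \<in> inversions C D"
        using inversions_subset_if_subset_twin_hull[OF C D FH] by blast
      then obtain e where e: "e \<in> D" "u i \<in> absorbed C e" "u j \<notin> absorbed C e"
        by (auto simp: inversions_def)
      have "d \<le> e \<or> e \<le> d" using flag_linear[OF D z(3) e(1)] .
      then show False using absorbed_mono[of d e C] absorbed_mono[of e d C] d e by blast
    qed
    then have "(u i, u j) \<in> inversions C D" using d z(3) u_range[OF ij(1)] by (auto simp: inversions_def)
    moreover have "(u i, u j) \<notin> inversions C F"
    proof
      assume "(u i, u j) \<in> inversions C F"
      then obtain p where p: "p \<in> F" "u j \<in> absorbed C p" "u i \<notin> absorbed C p"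
        by (auto simp: inversions_def)
      then show False
        using u_iff[OF ij(1) rank_le_top, of p] u_iff[OF ij(2) rank_le_top, of p] level_rank[OF F p(1)] z(2)
        by simp
    qed
    ultimately show "?g z \<in> inversions C D - inversions C F" using z(1) by simp
  qed
  ultimately have "card (inversions F D) \<le> card (inversions C D - inversions C F)"
    by (intro card_inj_on_le) simp_all
  also have "\<dots> = card (inversions C D) - card (inversions C F)"
    using inversions_subset_if_subset_twin_hull[OF C D FH] by (simp add: card_Diff_subset)
  finally show ?thesis
    using card_mono[OF finite_inversions inversions_subset_if_subset_twin_hull[OF C D FH]] by simp
qed

text \<open>From left to right, minimal walks through \<open>F\<close> are concatenated:
  \<open>card_inversions_add_le\<close> bounds the length from above, and the bound for all walks
  makes it minimal.\<close>

lemma flag_subset_twin_hull_iff: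
  fixes C D :: "'a::semimodular_lattice set"
  assumes C: "flag C" and D: "flag D" and F: "flag F"
  shows "F \<subseteq> twin_hull C D \<longleftrightarrow> (\<exists>Fs. shortest_gallery C D Fs \<and> F \<in> set Fs)"
proof
  assume FH: "F \<subseteq> twin_hull C D"
  obtain Fs where Fs: "walk C F Fs" "length Fs = Suc (card (inversions C F))"
    using ex_walk[OF C F] by blast
  obtain Gs where Gs: "walk F D Gs" "length Gs = Suc (card (inversions F D))"
    using ex_walk[OF F D] by blast
  have w: "walk C D (Fs @ tl Gs)" using walk_append[OF Fs(1) Gs(1)] .
  then have "length (Fs @ tl Gs) = Suc (card (inversions C D))"
    using card_inversions_less_length_walk[OF C w] card_inversions_add_le[OF C D F FH] Fs(2) Gs(2)
    by simp
  with w have "shortest_gallery C D (Fs @ tl Gs)" by (simp add: shortest_gallery_iff C D)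
  moreover have "F \<in> set (Fs @ tl Gs)" using Fs(1) by (auto simp: walk_def)
  ultimately show "\<exists>Fs. shortest_gallery C D Fs \<and> F \<in> set Fs" by blast
next
  assume "\<exists>Fs. shortest_gallery C D Fs \<and> F \<in> set Fs"
  then show "F \<subseteq> twin_hull C D"
    using tight_walk[OF C] by (auto simp: shortest_gallery_iff C D)
qed

theorem theorem3p1:
  fixes C D :: "'a::semimodular_lattice set" and n :: nat
  assumes "rank (top :: 'a) = n" and "flag C" and "flag D"
  shows "\<exists>K :: nat set set.
    (pre_antimatroid {1..n} K \<and> poset_isomorphic (mConv (C \<union> D)) K) \<and>
    (\<forall>F. flag F \<longrightarrow>
       (F \<subseteq> mConv (C \<union> D) \<longleftrightarrow> (\<exists>Fs. shortest_gallery C D Fs \<and> F \<in> set Fs))) \<and>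
    (antimatroid {1..n} (star {1..n} K) \<and>
     poset_isomorphic (\<Union>{F. \<exists>Fs. shortest_gallery C D Fs \<and> F \<in> set Fs}) (star {1..n} K))"
proof -
  let ?H = "twin_hull C D" and ?U = "\<Union>{F. \<exists>Fs. shortest_gallery C D Fs \<and> F \<in> set Fs}"
  let ?K = "absorbed C ` ?H"
  have H: "mConv (C \<union> D) = ?H" using assms(2,3) by (rule mConv_eq_twin_hull)
  have pre: "pre_antimatroid {1..n} ?K" using pre_antimatroid_absorbed[OF assms(2,3)] assms(1) by simp
  have iff: "F \<subseteq> ?H \<longleftrightarrow> (\<exists>Fs. shortest_gallery C D Fs \<and> F \<in> set Fs)" if "flag F" for F
    using assms(2,3) that by (rule flag_subset_twin_hull_iff)
  \<comment> \<open>Members of shortest galleries are flags, so their union is that of the flags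
    inside \<open>?H\<close>, as needed for \<open>star_absorbed\<close>.\<close>
  have "flag F" if "shortest_gallery C D Fs" "F \<in> set Fs" for F Fs
    using that by (simp add: shortest_gallery_iff assms walk_def)
  then have "{F. \<exists>Fs. shortest_gallery C D Fs \<and> F \<in> set Fs} = {F. flag F \<and> F \<subseteq> ?H}"
    using iff by blast
  then have U: "?U = \<Union>{F. flag F \<and> F \<subseteq> ?H}" by simp
  then have star: "star {1..n} ?K = absorbed C ` ?U"
    using star_absorbed[OF assms(2,3)] assms(1) by simp
  \<comment> \<open>Stated for any subset, to serve both \<open>?H\<close> and the union of the
    flags.\<close>
  have iso: "poset_isomorphic A (absorbed C ` A)" if "A \<subseteq> ?H" for A
    unfolding poset_isomorphic_def
  proof (intro exI conjI ballI)
    show "bij_betw (absorbed C) A (absorbed C ` A)"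
      using bij_betw_absorbed[OF assms(2,3)] that by (rule bij_betw_subset) simp
    show "x \<le> y \<longleftrightarrow> absorbed C x \<subseteq> absorbed C y" if "x \<in> A" "y \<in> A" for x y
      using absorbed_le_iff[OF assms(2,3)] that \<open>A \<subseteq> ?H\<close> by blast
  qed
  have "?U \<subseteq> ?H" unfolding U by blast
  have "pre_antimatroid {1..n} ?K \<and> poset_isomorphic ?H ?K" using pre iso[OF order_refl] ..
  moreover have "antimatroid {1..n} (star {1..n} ?K) \<and> poset_isomorphic ?U (star {1..n} ?K)"
    using antimatroid_star[OF pre] iso[OF \<open>?U \<subseteq> ?H\<close>] unfolding star ..
  ultimately show ?thesis unfolding H using iff by (intro exI[of _ ?K]) simp
qed

end
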